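(* Let $n\ge 3$, $L>0$, $M=[0,L]\times\mathbb{S}^{n-1}$ and $m\in[1,1+L/2)$. Let $\mathcal{M}_m$ be the set of all metrics of revolution on $M$ induced by a function $h$ such that $\max_{r\in[0,L]} h(r)\le m$. Then there exists a constant $C(n,L,m)>0$ such that for all $g\in\mathcal{M}_m$, $$B_n(L)-\sigma_1(M,g)\ge C(n,L,m).$$
   Context: Metric of revolution: for $L>0$ and $M=[0,L]\times\mathbb{S}^{n-1}$, a metric of revolution on $M$ induced by $h$ is a Riemannian metric of the form $g(r,p) = dr^2 + h^2(r) g_0(p)$, $(r,p)\in[0,L]\times\mathbb{S}^{n-1}$, where $g_0$ is the canonical metric of the unit $(n-1)$-sphere and $h:[0,L]\to(0,\infty)$ is a smooth function satisfying (1) $|h'(r)|\le 1$ for all $r\in[0,L]$ and (2) $h(0)=h(L)=1$. Steklov eigenvalues: for a smooth compact connected Riemannian manifold $(M,g)$ with smooth boundary $\Sigma$, these are the real numbers $\sigma$ for which there is a nonzero harmonic function $f:M\to\mathbb{R}$ with $\partial_\nu f = \sigma f$ on $\Sigma$ ($\nu$ the outward unit normal). They form a sequence $0=\sigma_0(M,g)<\sigma_1(M,g)\le\sigma_2(M,g)\le\dots\nearrow\infty$, repeated according to multiplicity. The bound $B_n(L)$ is $$B_n(L) := \min\left\{ \frac{(n-2)\left(1+L/2\right)^{n-2}}{\left(1+L/2\right)^{n-2}-1},\ \frac{(n-1)\left(\left(1+L/2\right)^n-1\right)}{\left(1+L/2\right)^n+n-1}\right\}.$$ *)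

theory Defs
  imports "HOL-Analysis.Analysis"
begin

section \<open>Smooth functions up to the boundary\<close>

text \<open>Derivatives are taken within S. If S is the closure of a smoothly bounded open set (or a
  compact interval), this is the usual class of C^k functions up to the boundary.\<close>

primrec Ck_on :: "nat \<Rightarrow> 'a::euclidean_space set \<Rightarrow> ('a \<Rightarrow> real) \<Rightarrow> bool" where
  "Ck_on 0 S f \<longleftrightarrow> continuous_on S f"
| "Ck_on (Suc k) S f \<longleftrightarrow>
     (\<exists>D. (\<forall>x\<in>S. (f has_derivative (\<lambda>v. \<Sum>b\<in>Basis. D b x * (v \<bullet> b))) (at x within S)) \<and>
          (\<forall>b\<in>Basis. Ck_on k S (D b)))"

definition smooth_on :: "'a::euclidean_space set \<Rightarrow> ('a \<Rightarrow> real) \<Rightarrow> bool" where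
  "smooth_on S f \<longleftrightarrow> (\<forall>k. Ck_on k S f)"


section \<open>The Steklov problem on a region with a Riemannian metric\<close>

text \<open>Here \<open>\<Omega>\<close> is a compact region with smooth boundary in \<open>\<real>\<^sup>n\<close>, and \<open>G x\<close> is the matrix of the
  metric at \<open>x\<close>.\<close>

definition partial :: "'n \<Rightarrow> (real^'n \<Rightarrow> real) \<Rightarrow> real^'n \<Rightarrow> real" where
  "partial i f x = frechet_derivative f (at x) (axis i 1)"

definition riemannian_gradient ::
    "(real^'n \<Rightarrow> real^'n^'n) \<Rightarrow> (real^'n \<Rightarrow> real) \<Rightarrow> real^'n \<Rightarrow> real^'n" where
  "riemannian_gradient G f x = matrix_inv (G x) *v (\<chi> j. partial j f x)"

definition riemannian_divergence ::
    "(real^'n \<Rightarrow> real^'n^'n) \<Rightarrow> (real^'n \<Rightarrow> real^'n) \<Rightarrow> real^'n \<Rightarrow> real" where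
  "riemannian_divergence G X x =
     (\<Sum>i\<in>UNIV. partial i (\<lambda>y. sqrt (det (G y)) * X y $ i) x) / sqrt (det (G x))"

definition laplace_beltrami ::
    "(real^'n \<Rightarrow> real^'n^'n) \<Rightarrow> (real^'n \<Rightarrow> real) \<Rightarrow> real^'n \<Rightarrow> real" where
  "laplace_beltrami G f = riemannian_divergence G (riemannian_gradient G f)"

definition harmonic_on ::
    "(real^'n) set \<Rightarrow> (real^'n \<Rightarrow> real^'n^'n) \<Rightarrow> (real^'n \<Rightarrow> real) \<Rightarrow> bool" where
  "harmonic_on \<Omega> G f \<longleftrightarrow> smooth_on \<Omega> f \<and> (\<forall>x\<in>interior \<Omega>. laplace_beltrami G f x = 0)"

definition tangent_vectors :: "(real^'n) set \<Rightarrow> real^'n \<Rightarrow> (real^'n) set" where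
  "tangent_vectors S x =
     {v. \<exists>\<gamma>. \<gamma> 0 = x \<and> (\<forall>t. \<gamma> t \<in> S) \<and> (\<gamma> has_vector_derivative v) (at (0::real))}"

definition outward_unit_normal ::
    "(real^'n) set \<Rightarrow> (real^'n \<Rightarrow> real^'n^'n) \<Rightarrow> real^'n \<Rightarrow> real^'n \<Rightarrow> bool" where
  "outward_unit_normal \<Omega> G x \<nu> \<longleftrightarrow>
     \<nu> \<bullet> (G x *v \<nu>) = 1 \<and>
     (\<forall>\<tau>\<in>tangent_vectors (frontier \<Omega>) x. \<tau> \<bullet> (G x *v \<nu>) = 0) \<and>
     (\<forall>\<^sub>F t in at_right 0. x + t *\<^sub>R \<nu> \<notin> \<Omega>)"

text \<open>The eigenspace of \<open>\<sigma>\<close>; it contains the zero function.\<close>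

definition steklov_eigenspace ::
    "(real^'n) set \<Rightarrow> (real^'n \<Rightarrow> real^'n^'n) \<Rightarrow> real \<Rightarrow> (real^'n \<Rightarrow> real) set" where
  "steklov_eigenspace \<Omega> G \<sigma> =
     {f. harmonic_on \<Omega> G f \<and>
         (\<forall>x\<in>frontier \<Omega>. \<forall>\<nu>. outward_unit_normal \<Omega> G x \<nu> \<longrightarrow>
            (\<exists>D. (f has_derivative D) (at x within \<Omega>) \<and> D \<nu> = \<sigma> * f x))}"

definition independent_on :: "'a set \<Rightarrow> nat set \<Rightarrow> (nat \<Rightarrow> 'a \<Rightarrow> real) \<Rightarrow> bool" where
  "independent_on \<Omega> I f \<longleftrightarrow>
     (\<forall>c. (\<forall>x\<in>\<Omega>. (\<Sum>i\<in>I. c i * f i x) = 0) \<longrightarrow> (\<forall>i\<in>I. c i = 0))"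

text \<open>The k-th eigenvalue (counted from 0, with multiplicity) is the least \<open>t\<close> such that at least
  k + 1 eigenvalues, counted with multiplicity, are at most \<open>t\<close>. Eigenfunctions of different
  eigenvalues are linearly independent, so the number of eigenvalues at most \<open>t\<close> is the maximal size
  of a linearly independent family of eigenfunctions whose eigenvalues are at most \<open>t\<close>; independence
  on \<open>\<Omega>\<close> also forces each of these functions to be nonzero there. The infimum is taken in the
  extended reals, where it is meaningful without knowing in advance that the set is nonempty and
  bounded below.\<close>

definition steklov_value ::
    "(real^'n) set \<Rightarrow> (real^'n \<Rightarrow> real^'n^'n) \<Rightarrow> nat \<Rightarrow> ereal" where
  "steklov_value \<Omega> G k =
     Inf {ereal t | t. \<exists>\<sigma> f. (\<forall>i\<le>k. \<sigma> i \<le> t \<and> f i \<in> steklov_eigenspace \<Omega> G (\<sigma> i)) \<and>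
                              independent_on \<Omega> {..k} f}"


section \<open>Metrics of revolution\<close>

text \<open>A metric on \<open>M = [0,L] \<times> S\<close>, with \<open>S\<close> the unit sphere of \<open>\<real>\<^sup>n\<close>, is a function of a point
  \<open>(r, p)\<close> and two tangent vectors \<open>(a, v)\<close>, \<open>(b, w)\<close>, where \<open>v\<close> and \<open>w\<close> are orthogonal to \<open>p\<close>.
  The canonical metric of \<open>S\<close> is the restriction of the inner product.\<close>

type_synonym 'n metric =
  "real \<times> (real^'n) \<Rightarrow> real \<times> (real^'n) \<Rightarrow> real \<times> (real^'n) \<Rightarrow> real"

definition revolution_metric :: "(real \<Rightarrow> real) \<Rightarrow> 'n::finite metric" where
  "revolution_metric h = (\<lambda>(r, p) (a, v) (b, w). a * b + (h r)\<^sup>2 * (v \<bullet> w))"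

definition profile :: "real \<Rightarrow> (real \<Rightarrow> real) \<Rightarrow> bool" where
  "profile L h \<longleftrightarrow>
     smooth_on {0..L} h \<and> (\<forall>r\<in>{0..L}. 0 < h r) \<and>
     (\<exists>h'. \<forall>r\<in>{0..L}. (h has_real_derivative h' r) (at r within {0..L}) \<and> \<bar>h' r\<bar> \<le> 1) \<and>
     h 0 = 1 \<and> h L = 1"

definition revolution_metrics :: "real \<Rightarrow> real \<Rightarrow> 'n::finite metric set" where
  "revolution_metrics L m =
     {revolution_metric h | h. profile L h \<and> (\<forall>r\<in>{0..L}. h r \<le> m)}"

text \<open>\<open>M\<close> is covered by one global chart, defined on a closed spherical shell in \<open>\<real>\<^sup>n\<close>.\<close>

definition shell :: "real \<Rightarrow> (real^'n) set" where
  "shell L = {x. 1 \<le> norm x \<and> norm x \<le> 1 + L}"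

definition polar :: "real^'n \<Rightarrow> real \<times> (real^'n)" where
  "polar x = (norm x - 1, x /\<^sub>R norm x)"

lemma polar_bij_betw:
  "bij_betw polar (shell L :: (real^'n) set) ({0..L} \<times> sphere 0 1)"
proof (rule bij_betw_byWitness[where f' = "\<lambda>(r, p). (1 + r) *\<^sub>R p"])
  have nz: "norm x \<noteq> 0" if "x \<in> shell L" for x :: "real^'n"
    using that by (auto simp: shell_def)
  show "\<forall>x\<in>shell L :: (real^'n) set. (case polar x of (r, p) \<Rightarrow> (1 + r) *\<^sub>R p) = x"
    using nz by (auto simp: polar_def)
  show "polar ` (shell L :: (real^'n) set) \<subseteq> {0..L} \<times> sphere 0 1"
  proof (rule image_subsetI)
    fix x :: "real^'n" assume "x \<in> shell L"
    then show "polar x \<in> {0..L} \<times> sphere 0 1"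
      using nz[of x] by (simp add: polar_def shell_def)
  qed
qed (auto simp: shell_def polar_def)

definition pullback_metric :: "'n::finite metric \<Rightarrow> real^'n \<Rightarrow> real^'n^'n" where
  "pullback_metric g x =
     (\<chi> i j. g (polar x) (frechet_derivative polar (at x) (axis i 1))
                        (frechet_derivative polar (at x) (axis j 1)))"

text \<open>\<open>steklov_sigma L g k\<close> is the k-th Steklov eigenvalue of \<open>(M, g)\<close>, computed in this chart.\<close>

definition steklov_sigma :: "real \<Rightarrow> 'n::finite metric \<Rightarrow> nat \<Rightarrow> ereal" where
  "steklov_sigma L g k = steklov_value (shell L) (pullback_metric g) k"

definition B :: "nat \<Rightarrow> real \<Rightarrow> real" where
  "B n L = min
     ((real n - 2) * (1 + L / 2) ^ (n - 2) / ((1 + L / 2) ^ (n - 2) - 1))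
     ((real n - 1) * ((1 + L / 2) ^ n - 1) / ((1 + L / 2) ^ n + real n - 1))"

end

theory Submission
  imports Defs
begin

text \<open>
  Write the dimension as n. By separation of variables, for an angular function Y with spherical
  eigenvalue lam, a(r) Y is a Steklov eigenfunction as soon as (h^(n-1) a')' = lam h^(n-3) a with
  - a'(0) = \<sigma> a(0) and a'(L) = \<sigma> a(L). For Y = 1 this is explicit and gives
  \<sigma> = 2 / \<integral> h^(1-n). For Y = x_i / |x| the smaller of the two values of \<sigma> is at most half of the
  energy \<integral> h^(n-1) \<phi>'^2 + (n-1) h^(n-3) \<phi>^2 of any \<phi> with \<phi>(0) = \<phi>(L) = 1, by the Dirichlet
  principle; \<phi> is taken from the mixed Steklov-Neumann problem on the annulus with radii 1 and
  1 + L/2, reflected at L/2. Both bounds increase with h, and h r is at most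
  min (1 + r) (1 + L - r), at which they become the two terms of B. The bound h \<le> m truncates
  this envelope near L/2, which costs a fixed positive amount.
\<close>

subsection \<open>Calculus of the classes of continuously differentiable functions\<close>

text \<open>\<open>steklov_value\<close> is an infimum over families of genuine eigenfunctions, not
  a Rayleigh quotient over test functions. An upper bound therefore needs an exhibited harmonic
  function that is smooth up to the boundary and satisfies the Steklov condition exactly; a test
  function on the shell proves nothing by itself. Separation moves the variational argument to one
  dimension: for fixed \<open>Y\<close> the boundary values of a radial solution determine its
  outward fluxes through a symmetric two by two matrix, whose eigenvalues are Steklov eigenvalues.
  The factor one half comes from the squared length 2 of (1, 1) in the Rayleigh quotient of this
  matrix.

  For the profile 1 + t the energy density of the annulus mode is an exact derivative, and the
  Neumann condition removes its boundary term at L/2; what remains at 0 is precisely the second term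
  of \<open>B\<close>. All comparison integrals involve only the truncated envelope, never
  \<open>h\<close> itself, so the gap is uniform over the class. Both terms of \<open>B\<close> have
  to be beaten, since either may be the minimum.\<close>

lemma Ck_on_SucI:
  assumes "\<And>x. x \<in> S \<Longrightarrow> (f has_derivative (\<lambda>v. \<Sum>b\<in>Basis. D b x * (v \<bullet> b))) (at x within S)"
    and "\<And>b. b \<in> Basis \<Longrightarrow> Ck_on k S (D b)"
  shows "Ck_on (Suc k) S f"
  using assms by auto

lemma Ck_on_Suc_imp: "Ck_on (Suc k) S f \<Longrightarrow> Ck_on k S f"
proof (induction k arbitrary: f)
  case 0
  then show ?case
    by (auto simp: continuous_on_eq_continuous_within intro: has_derivative_continuous)
next
  case (Suc k)
  then obtain D where D: "\<forall>x\<in>S. (f has_derivative (\<lambda>v. \<Sum>b\<in>Basis. D b x * (v \<bullet> b))) (at x within S)"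
    "\<forall>b\<in>Basis. Ck_on (Suc k) S (D b)" by (auto simp del: Ck_on.simps simp: Ck_on.simps(2)[of "Suc k"])
  show ?case by (rule Ck_on_SucI[of _ _ D]) (use D Suc.IH in \<open>auto simp del: Ck_on.simps\<close>)
qed

lemma Ck_on_const [simp]: "Ck_on k S (\<lambda>x. c)"
proof (induction k arbitrary: c)
  case (Suc k)
  show ?case by (rule Ck_on_SucI[of _ _ "\<lambda>b x. 0"]) (auto simp: Suc)
qed auto

lemma Ck_on_inner [simp]: "Ck_on k S (\<lambda>x. x \<bullet> c)"
proof (cases k)
  case (Suc j)
  have "((\<lambda>x. x \<bullet> c) has_derivative (\<lambda>v. \<Sum>b\<in>Basis. (c \<bullet> b) * (v \<bullet> b))) (at x within S)" for x
  proof -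
    have "v \<bullet> c = (\<Sum>b\<in>Basis. (c \<bullet> b) * (v \<bullet> b))" for v
      by (subst euclidean_inner) (simp add: mult.commute)
    then show ?thesis
      using has_derivative_inner_left[OF has_derivative_ident, of c "at x within S"] by simp
  qed
  then show ?thesis unfolding Suc by (intro Ck_on_SucI[of _ _ "\<lambda>b x. c \<bullet> b"]) auto
qed (auto intro: continuous_intros)

lemma Ck_on_add:
  assumes "Ck_on k S f" "Ck_on k S g"
  shows "Ck_on k S (\<lambda>x. f x + g x)"
  using assms
proof (induction k arbitrary: f g)
  case 0
  then show ?case by (auto intro: continuous_intros)
next
  case (Suc k)
  from Suc.prems obtain D E where
    D: "\<forall>x\<in>S. (f has_derivative (\<lambda>v. \<Sum>b\<in>Basis. D b x * (v \<bullet> b))) (at x within S)"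
    "\<forall>b\<in>Basis. Ck_on k S (D b)" and
    E: "\<forall>x\<in>S. (g has_derivative (\<lambda>v. \<Sum>b\<in>Basis. E b x * (v \<bullet> b))) (at x within S)"
    "\<forall>b\<in>Basis. Ck_on k S (E b)" by auto
  show ?case
  proof (rule Ck_on_SucI[of _ _ "\<lambda>b x. D b x + E b x"])
    fix x assume "x \<in> S"
    then show "((\<lambda>x. f x + g x) has_derivative (\<lambda>v. \<Sum>b\<in>Basis. (D b x + E b x) * (v \<bullet> b))) (at x within S)"
      using has_derivative_add D(1) E(1) by (fastforce simp: distrib_right sum.distrib)
  qed (use D E Suc.IH in auto)
qed

lemma Ck_on_mult:
  assumes "Ck_on k S f" "Ck_on k S g"
  shows "Ck_on k S (\<lambda>x. f x * g x)"
  using assms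
proof (induction k arbitrary: f g)
  case 0
  then show ?case by (auto intro: continuous_intros)
next
  case (Suc k)
  from Suc.prems obtain D E where
    D: "\<forall>x\<in>S. (f has_derivative (\<lambda>v. \<Sum>b\<in>Basis. D b x * (v \<bullet> b))) (at x within S)"
    "\<forall>b\<in>Basis. Ck_on k S (D b)" and
    E: "\<forall>x\<in>S. (g has_derivative (\<lambda>v. \<Sum>b\<in>Basis. E b x * (v \<bullet> b))) (at x within S)"
    "\<forall>b\<in>Basis. Ck_on k S (E b)" by auto
  show ?case
  proof (rule Ck_on_SucI[of _ _ "\<lambda>b x. f x * E b x + D b x * g x"])
    fix x assume "x \<in> S"
    then have "((\<lambda>x. f x * g x) has_derivative
       (\<lambda>v. f x * (\<Sum>b\<in>Basis. E b x * (v \<bullet> b)) + (\<Sum>b\<in>Basis. D b x * (v \<bullet> b)) * g x)) (at x within S)"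
      using has_derivative_mult D(1) E(1) by blast
    then show "((\<lambda>x. f x * g x) has_derivative (\<lambda>v. \<Sum>b\<in>Basis. (f x * E b x + D b x * g x) * (v \<bullet> b))) (at x within S)"
      by (simp add: algebra_simps sum.distrib sum_distrib_left sum_distrib_right)
  next
    fix b :: 'a assume b: "b \<in> Basis"
    show "Ck_on k S (\<lambda>x. f x * E b x + D b x * g x)"
      using b D(2) E(2) Suc.prems[THEN Ck_on_Suc_imp] by (intro Ck_on_add Suc.IH) auto
  qed
qed

lemma Ck_on_power: "Ck_on k S f \<Longrightarrow> Ck_on k S (\<lambda>x. f x ^ j)"
  by (induction j) (auto intro: Ck_on_mult)

lemma Ck_on_inverse:
  assumes "Ck_on k S f" "\<And>x. x \<in> S \<Longrightarrow> f x \<noteq> 0"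
  shows "Ck_on k S (\<lambda>x. inverse (f x))"
  using assms
proof (induction k arbitrary: f)
  case 0
  then show ?case by (auto intro: continuous_intros)
next
  case (Suc k)
  from Suc.prems obtain D where
    D: "\<forall>x\<in>S. (f has_derivative (\<lambda>v. \<Sum>b\<in>Basis. D b x * (v \<bullet> b))) (at x within S)"
    "\<forall>b\<in>Basis. Ck_on k S (D b)" by auto
  have inv: "Ck_on k S (\<lambda>x. inverse (f x))"
    using Suc Ck_on_Suc_imp by blast
  show ?case
  proof (rule Ck_on_SucI[of _ _ "\<lambda>b x. (-1 * D b x) * (inverse (f x) * inverse (f x))"])
    fix x assume x: "x \<in> S"
    then have "((\<lambda>x. inverse (f x)) has_derivative
       (\<lambda>v. - (inverse (f x) * (\<Sum>b\<in>Basis. D b x * (v \<bullet> b)) * inverse (f x)))) (at x within S)"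
      using D(1) Suc.prems(2)[OF x] by (intro Deriv.has_derivative_inverse) auto
    then show "((\<lambda>x. inverse (f x)) has_derivative
        (\<lambda>v. \<Sum>b\<in>Basis. -1 * D b x * (inverse (f x) * inverse (f x)) * (v \<bullet> b))) (at x within S)"
      by (simp add: sum_distrib_left sum_distrib_right sum_negf mult_ac)
  next
    fix b :: 'a assume b: "b \<in> Basis"
    with D(2) inv show "Ck_on k S (\<lambda>x. -1 * D b x * (inverse (f x) * inverse (f x)))"
      by (intro Ck_on_mult Ck_on_const) auto
  qed
qed

text \<open>The partial derivatives of the norm are coordinates times the inverse norm, so the
  induction feeds on itself.\<close>

lemma Ck_on_norm:
  fixes S :: "'a::euclidean_space set"
  assumes "0 \<notin> S"
  shows "Ck_on k S norm"
proof (induction k)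
  case 0
  then show ?case by (auto intro: continuous_intros)
next
  case (Suc k)
  show ?case
  proof (rule Ck_on_SucI[of _ _ "\<lambda>b x. (x \<bullet> b) * inverse (norm x)"])
    fix x assume "x \<in> S"
    with assms have "x \<noteq> 0" by auto
    have eq: "v \<bullet> sgn x = (\<Sum>b\<in>Basis. (x \<bullet> b) * inverse (norm x) * (v \<bullet> b))" for v
      by (subst euclidean_inner) (simp add: sgn_div_norm mult_ac)
    from has_derivative_at_withinI[OF has_derivative_norm[OF \<open>x \<noteq> 0\<close>]]
    show "(norm has_derivative (\<lambda>v. \<Sum>b\<in>Basis. (x \<bullet> b) * inverse (norm x) * (v \<bullet> b))) (at x within S)"
      by (simp only: eq)
  next
    fix b :: 'a assume "b \<in> Basis"
    show "Ck_on k S (\<lambda>x. (x \<bullet> b) * inverse (norm x))"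
      using assms by (intro Ck_on_mult Ck_on_inner Ck_on_inverse Suc) auto
  qed
qed

lemma Ck_on_Suc_real:
  fixes S :: "real set"
  shows "Ck_on (Suc k) S f \<longleftrightarrow> (\<exists>f'. (\<forall>x\<in>S. (f has_real_derivative f' x) (at x within S)) \<and> Ck_on k S f')"
  (is "?A \<longleftrightarrow> ?B")
proof
  assume ?A then obtain D where "\<forall>x\<in>S. (f has_derivative (\<lambda>v. \<Sum>b\<in>Basis. D b x * (v \<bullet> b))) (at x within S)"
    "\<forall>b\<in>Basis. Ck_on k S (D b)" by auto
  then show ?B by (intro exI[of _ "D 1"]) (auto simp: has_field_derivative_def)
next
  assume ?B then obtain f' where "\<forall>x\<in>S. (f has_real_derivative f' x) (at x within S)" "Ck_on k S f'" by blast
  then show ?A by (intro Ck_on_SucI[of _ _ "\<lambda>b. f'"]) (auto simp: has_field_derivative_def)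
qed

lemma Ck_on_compose:
  fixes g :: "'a::euclidean_space \<Rightarrow> real"
  assumes "Ck_on k T f" "Ck_on k S g" "g ` S \<subseteq> T"
  shows "Ck_on k S (\<lambda>x. f (g x))"
  using assms(1,2)
proof (induction k arbitrary: f)
  case 0
  then show ?case using assms(3) by (auto intro: continuous_on_compose2)
next
  case (Suc k)
  from Suc.prems(1) obtain f' where
    f': "\<forall>x\<in>T. (f has_real_derivative f' x) (at x within T)" "Ck_on k T f'"
    unfolding Ck_on_Suc_real by blast
  from Suc.prems(2) obtain D where
    D: "\<forall>x\<in>S. (g has_derivative (\<lambda>v. \<Sum>b\<in>Basis. D b x * (v \<bullet> b))) (at x within S)"
    "\<forall>b\<in>Basis. Ck_on k S (D b)" by auto
  show ?case
  proof (rule Ck_on_SucI[of _ _ "\<lambda>b x. f' (g x) * D b x"])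
    fix x assume x: "x \<in> S"
    have "(f has_derivative (*) (f' (g x))) (at (g x) within g ` S)"
      using f'(1) x assms(3) by (meson has_derivative_subset has_field_derivative_def image_eqI subsetD)
    from has_derivative_in_compose[OF _ this] D(1) x
    show "((\<lambda>x. f (g x)) has_derivative (\<lambda>v. \<Sum>b\<in>Basis. f' (g x) * D b x * (v \<bullet> b))) (at x within S)"
      by (fastforce simp: sum_distrib_left mult_ac)
  next
    fix b :: 'a assume "b \<in> Basis"
    then show "Ck_on k S (\<lambda>x. f' (g x) * D b x)"
      using D f' Suc.IH[OF f'(2)] Ck_on_Suc_imp[OF Suc.prems(2)] by (intro Ck_on_mult) auto
  qed
qed

text \<open>Bootstrapping: each derivative is a smooth coefficient times the other unknown, so both
  functions gain one order of regularity together. This gives radial solutions that are smooth up to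
  the boundary.\<close>

lemma Ck_on_linear_system:
  fixes S :: "real set"
  assumes "\<And>r. r \<in> S \<Longrightarrow> (u has_real_derivative P r * w r) (at r within S)"
    and "\<And>r. r \<in> S \<Longrightarrow> (w has_real_derivative q r * u r) (at r within S)"
    and "\<And>k. Ck_on k S P" "\<And>k. Ck_on k S q"
  shows "Ck_on k S u \<and> Ck_on k S w"
proof (induction k)
  case 0
  have "continuous_on S u" "continuous_on S w"
    by (rule DERIV_continuous_on, rule assms(1), assumption,
        rule DERIV_continuous_on, rule assms(2), assumption)
  then show ?case by simp
next
  case (Suc k)
  then have "Ck_on k S (\<lambda>r. P r * w r)" "Ck_on k S (\<lambda>r. q r * u r)"
    using assms(3,4) by (auto intro: Ck_on_mult)
  then show ?case unfolding Ck_on_Suc_real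
    using assms(1,2) by (intro conjI exI[of _ "\<lambda>r. P r * w r"] exI[of _ "\<lambda>r. q r * u r"]) auto
qed

subsection \<open>The metric in the chart\<close>

text \<open>The matrix c I + (1 - c) u u^T. For a unit vector \<open>u\<close> it is the identity
  along \<open>u\<close> and multiplication by \<open>c\<close> on the orthogonal
  complement.\<close>

definition radial_matrix :: "real \<Rightarrow> real^'n \<Rightarrow> real^'n^'n" where
  "radial_matrix c u = (\<chi> i j. c * (if i = j then 1 else 0) + (1 - c) * (u $ i * u $ j))"

lemma radial_matrix_vector:
  "radial_matrix c u *v v = c *\<^sub>R v + ((1 - c) * (u \<bullet> v)) *\<^sub>R u"
proof (rule vec_eq_iff[THEN iffD2], rule allI)
  fix i
  have "(radial_matrix c u *v v) $ i =
      (\<Sum>j\<in>UNIV. (if i = j then c * v $ j else 0) + (1 - c) * (u $ i * (u $ j * v $ j)))"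
    unfolding matrix_vector_mult_def radial_matrix_def
    by (intro trans[OF vec_lambda_beta] sum.cong) (auto simp: algebra_simps)
  also have "\<dots> = (c *\<^sub>R v + ((1 - c) * (u \<bullet> v)) *\<^sub>R u) $ i"
    by (simp add: sum.distrib inner_vec_def sum_distrib_left mult_ac)
  finally show "(radial_matrix c u *v v) $ i = (c *\<^sub>R v + ((1 - c) * (u \<bullet> v)) *\<^sub>R u) $ i" .
qed

lemma matrix_inv_eqI:
  fixes A :: "'a::semiring_1^'n^'n"
  assumes "A ** X = mat 1" "X ** A = mat 1"
  shows "matrix_inv A = X"
proof -
  have "A ** matrix_inv A = mat 1 \<and> matrix_inv A ** A = mat 1"
    unfolding matrix_inv_def by (rule someI[of _ X]) (use assms in auto)
  then show ?thesis
    using assms by (metis matrix_mul_assoc matrix_mul_lid matrix_mul_rid)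
qed

lemma matrix_inv_radial_matrix:
  assumes "norm u = 1" "c \<noteq> 0"
  shows "matrix_inv (radial_matrix c u) = radial_matrix (1 / c) u"
proof (rule matrix_inv_eqI)
  have "radial_matrix c u ** radial_matrix d u = mat 1" if "c * d = 1" for c d
  proof -
    have "radial_matrix c u *v (radial_matrix d u *v v) = v" for v
    proof -
      have "u \<bullet> u = 1" using assms(1) by (simp add: norm_eq_1)
      then have "radial_matrix c u *v (radial_matrix d u *v v)
          = (c * d) *\<^sub>R v + ((1 - c * d) * (u \<bullet> v)) *\<^sub>R u"
        unfolding radial_matrix_vector
        by (simp add: inner_add_right algebra_simps)
      with that show ?thesis by simp
    qed
    then show ?thesis
      by (simp add: matrix_eq matrix_vector_mul_assoc[symmetric])
  qed
  then show "radial_matrix c u ** radial_matrix (1 / c) u = mat 1"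
    "radial_matrix (1 / c) u ** radial_matrix c u = mat 1" using assms by auto
qed

text \<open>An orthogonal change of basis moves \<open>u\<close> to a coordinate axis, where the
  matrix is diagonal with one entry 1 and all others \<open>c\<close>.\<close>

lemma det_radial_matrix:
  fixes u :: "real^'n"
  assumes "norm u = 1"
  shows "det (radial_matrix c u) = c ^ (CARD('n) - 1)"
proof -
  obtain k :: 'n and A where A: "orthogonal_matrix A" "A *v axis k 1 = u"
    using orthogonal_matrix_exists_basis[OF assms] by blast
  let ?R = "radial_matrix c (axis k 1) :: real^'n^'n"
  have "radial_matrix c u *v v = A *v (?R *v (transpose A *v v))" for v
  proof -
    have "axis k 1 \<bullet> (transpose A *v v) = u \<bullet> v"
      using A(2) by (metis dot_lmul_matrix transpose_matrix_vector transpose_transpose)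
    moreover have "A *v (transpose A *v v) = v"
      using A(1) by (simp add: matrix_vector_mul_assoc orthogonal_matrix_def
          del: transpose_matrix_vector)
    ultimately show ?thesis
      using A(2) unfolding radial_matrix_vector
      by (simp add: matrix_vector_right_distrib matrix_vector_mult_scaleR)
  qed
  then have "radial_matrix c u = A ** ?R ** transpose A"
    by (simp add: matrix_eq matrix_vector_mul_assoc[symmetric])
  then have "det (radial_matrix c u) = det (transpose A ** A) * det ?R"
    by (simp add: det_mul det_transpose)
  also have "\<dots> = det ?R"
    using A(1) by (simp add: orthogonal_matrix)
  also have "\<dots> = (\<Prod>i\<in>UNIV. ?R $ i $ i)"
    by (rule det_diagonal) (auto simp: radial_matrix_def axis_def)
  also have "\<dots> = (\<Prod>i\<in>UNIV. if i = k then 1 else c)"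
    by (rule prod.cong) (auto simp: radial_matrix_def axis_def)
  also have "\<dots> = c ^ (CARD('n) - 1)"
    by (simp add: prod.If_cases Compl_eq_Diff_UNIV)
  finally show ?thesis .
qed

lemma polar_has_derivative:
  fixes x :: "real^'n"
  assumes "x \<noteq> 0"
  shows "(polar has_derivative
           (\<lambda>v. (sgn x \<bullet> v, (v - (sgn x \<bullet> v) *\<^sub>R sgn x) /\<^sub>R norm x))) (at x)"
proof -
  have n: "(norm has_derivative (\<lambda>v. sgn x \<bullet> v)) (at x)"
    using has_derivative_norm[OF assms] by (simp add: inner_commute)
  have "((\<lambda>x. x /\<^sub>R norm x) has_derivative
      (\<lambda>v. v /\<^sub>R norm x + (- (inverse (norm x) * (sgn x \<bullet> v) * inverse (norm x))) *\<^sub>R x)) (at x)"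
    using has_derivative_scaleR[OF Deriv.has_derivative_inverse[OF _ n] has_derivative_ident] assms
    by simp
  also have "(\<lambda>v. v /\<^sub>R norm x + (- (inverse (norm x) * (sgn x \<bullet> v) * inverse (norm x))) *\<^sub>R x)
     = (\<lambda>v. (v - (sgn x \<bullet> v) *\<^sub>R sgn x) /\<^sub>R norm x)"
    by (auto simp: sgn_div_norm algebra_simps)
  finally have "((\<lambda>x. x /\<^sub>R norm x) has_derivative
      (\<lambda>v. (v - (sgn x \<bullet> v) *\<^sub>R sgn x) /\<^sub>R norm x)) (at x)" .
  moreover have "((\<lambda>x. norm x - 1) has_derivative (\<lambda>v. sgn x \<bullet> v)) (at x)"
    using has_derivative_diff[OF n has_derivative_const[of 1]] by simp
  ultimately show ?thesis
    unfolding polar_def[abs_def] by (intro has_derivative_Pair)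
qed

text \<open>The derivative of \<open>polar\<close> keeps the radial component of a vector and
  divides the tangential one by \<open>norm x\<close>; the metric then scales the tangential part by
  \<open>h\<close>. Hence tangential lengths carry the factor h / |x|, and radial lengths are
  unchanged.\<close>

lemma pullback_revolution_metric:
  fixes x :: "real^'n"
  assumes "x \<noteq> 0"
  shows "pullback_metric (revolution_metric h) x =
           radial_matrix ((h (norm x - 1) / norm x)\<^sup>2) (sgn x)"
proof -
  have D: "frechet_derivative polar (at x) =
     (\<lambda>v. (sgn x \<bullet> v, (v - (sgn x \<bullet> v) *\<^sub>R sgn x) /\<^sub>R norm x))"
    using frechet_derivative_at[OF polar_has_derivative[OF assms]] by simp
  have u: "sgn x \<bullet> sgn x = 1"
    using assms by (simp add: norm_eq_1[symmetric] norm_sgn)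
  have "pullback_metric (revolution_metric h) x $ i $ j =
           radial_matrix ((h (norm x - 1) / norm x)\<^sup>2) (sgn x) $ i $ j" for i j
  proof -
    let ?u = "sgn x"
    have "(axis i 1 - (?u \<bullet> axis i 1) *\<^sub>R ?u) \<bullet> (axis j 1 - (?u \<bullet> axis j 1) *\<^sub>R ?u)
       = (if i = j then 1 else 0) - ?u $ i * ?u $ j"
      using u by (simp add: inner_diff_left inner_diff_right inner_axis_axis inner_axis inner_axis' algebra_simps)
        (simp add: axis_def)
    then show ?thesis
      using assms
      by (simp add: pullback_metric_def revolution_metric_def D polar_def radial_matrix_def
          inner_axis power_divide power2_eq_square divide_simps) (simp add: algebra_simps)
  qed
  then show ?thesis by (simp add: vec_eq_iff)
qed

subsection \<open>Separation of variables\<close>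

lemma partial_eq: "(f has_derivative D) (at x) \<Longrightarrow> partial i f x = D (axis i 1)"
  unfolding partial_def using frechet_derivative_at by metis

text \<open>\<open>frechet_derivative\<close> is a choice from the set of derivatives. Functions
  that agree near \<open>x\<close> have the same set there, so the choices coincide even without
  differentiability.\<close>

lemma partial_cong:
  assumes "open U" "x \<in> U" "\<And>y. y \<in> U \<Longrightarrow> f y = g y"
  shows "partial i f x = partial i g x"
proof -
  have "(f has_derivative D) (at x) = (g has_derivative D) (at x)" for D
    using has_derivative_transform_within_open[OF _ assms(1,2), of f D UNIV g]
      has_derivative_transform_within_open[OF _ assms(1,2), of g D UNIV f] assms(3) by auto
  then show ?thesis unfolding partial_def frechet_derivative_def by simp
qed

text \<open>\<open>Y\<close> is a function of the direction alone whose restriction to the unit sphere is an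
  eigenfunction of the Laplacian of the sphere with eigenvalue \<open>lam\<close>; \<open>Z\<close> is its gradient.\<close>

locale angular_eigenfunction =
  fixes Y :: "real^'n \<Rightarrow> real" and Z :: "real^'n \<Rightarrow> real^'n" and Z' :: "real^'n \<Rightarrow> real^'n \<Rightarrow> real^'n"
    and lam :: real
  assumes Y_deriv: "x \<noteq> 0 \<Longrightarrow> (Y has_derivative (\<lambda>v. Z x \<bullet> v)) (at x)"
    and Z_deriv: "x \<noteq> 0 \<Longrightarrow> (Z has_derivative Z' x) (at x)"
    and Z_orthogonal: "x \<noteq> 0 \<Longrightarrow> Z x \<bullet> x = 0"
    and Z_div: "x \<noteq> 0 \<Longrightarrow> (\<Sum>i\<in>UNIV. Z' x (axis i 1) $ i) = - lam * Y x / (norm x)\<^sup>2"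
    and Y_Ck: "0 \<notin> S \<Longrightarrow> Ck_on k S Y"
begin

text \<open>The mixed terms pair \<open>Z x\<close> with the radial direction and vanish by
  orthogonality. Only the radial derivative of \<alpha>, the divergence n of the position field and
  the divergence of \<open>Z\<close> survive.\<close>

lemma divergence_radial_field:
  fixes \<alpha> \<beta> :: "real \<Rightarrow> real"
  assumes x: "x \<noteq> 0"
    and al: "(\<alpha> has_real_derivative \<alpha>') (at (norm x))"
    and be: "(\<beta> has_real_derivative \<beta>') (at (norm x))"
  shows "(\<Sum>i\<in>UNIV. partial i (\<lambda>y. \<alpha> (norm y) * Y y * y $ i + \<beta> (norm y) * Z y $ i) x) =
     (\<alpha>' * norm x + real CARD('n) * \<alpha> (norm x)) * Y x - \<beta> (norm x) * lam * Y x / (norm x)\<^sup>2"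
proof -
  let ?\<rho> = "norm x"
  have n: "(norm has_derivative (\<lambda>v. sgn x \<bullet> v)) (at x)"
    using has_derivative_norm[OF x] by (simp add: inner_commute)
  have A: "((\<lambda>y. \<alpha> (norm y)) has_derivative (\<lambda>v. \<alpha>' * (sgn x \<bullet> v))) (at x)"
    and B: "((\<lambda>y. \<beta> (norm y)) has_derivative (\<lambda>v. \<beta>' * (sgn x \<bullet> v))) (at x)"
    using has_derivative_compose[OF n] al be unfolding has_field_derivative_def by blast+
  have P: "partial i (\<lambda>y. \<alpha> (norm y) * Y y * y $ i + \<beta> (norm y) * Z y $ i) x =
      (\<alpha>' * Y x) * (sgn x $ i * x $ i) + \<alpha> ?\<rho> * (Z x $ i * x $ i) + \<alpha> ?\<rho> * Y x
      + \<beta>' * (sgn x $ i * Z x $ i) + \<beta> ?\<rho> * Z' x (axis i 1) $ i" for i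
  proof -
    have c: "((\<lambda>y. y $ i) has_derivative (\<lambda>v. v $ i)) (at x)"
      by (intro bounded_linear_imp_has_derivative bounded_linear_vec_nth)
    have z: "((\<lambda>y. Z y $ i) has_derivative (\<lambda>v. Z' x v $ i)) (at x)"
      using bounded_linear.has_derivative[OF bounded_linear_vec_nth Z_deriv[OF x]] .
    show ?thesis
      by (subst partial_eq[OF has_derivative_add[OF has_derivative_mult[OF
          has_derivative_mult[OF A Y_deriv[OF x]] c] has_derivative_mult[OF B z]]])
        (simp add: inner_axis algebra_simps)
  qed
  have s1: "(\<Sum>i\<in>UNIV. sgn x $ i * x $ i) = ?\<rho>"
  proof -
    have "(\<Sum>i\<in>UNIV. sgn x $ i * x $ i) = sgn x \<bullet> x" by (simp add: inner_vec_def)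
    also have "\<dots> = ?\<rho>"
      using x by (simp add: sgn_div_norm power2_norm_eq_inner[symmetric] power2_eq_square)
    finally show ?thesis .
  qed
  have s2: "(\<Sum>i\<in>UNIV. Z x $ i * x $ i) = 0"
    using Z_orthogonal[OF x] by (simp add: inner_vec_def)
  have s3: "(\<Sum>i\<in>UNIV. sgn x $ i * Z x $ i) = 0"
  proof -
    have "(\<Sum>i\<in>UNIV. sgn x $ i * Z x $ i) = sgn x \<bullet> Z x" by (simp add: inner_vec_def)
    also have "\<dots> = 0" using Z_orthogonal[OF x] by (simp add: sgn_div_norm inner_commute)
    finally show ?thesis .
  qed  show ?thesis
    unfolding P sum.distrib sum_distrib_left[symmetric] s1 s2 s3 Z_div[OF x]
    by (simp add: algebra_simps)
qed

text \<open>Differentiation within sets serves the Steklov condition: on the boundary of the shell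
  \<open>a\<close> is differentiable only from one side.\<close>

lemma separated_has_derivative:
  assumes x: "x \<in> S" "x \<noteq> 0" and S: "(\<lambda>x. norm x - 1) ` S \<subseteq> T"
    and a: "(a has_real_derivative a') (at (norm x - 1) within T)"
  shows "((\<lambda>x. a (norm x - 1) * Y x) has_derivative
      (\<lambda>v. ((a' * Y x) *\<^sub>R sgn x + a (norm x - 1) *\<^sub>R Z x) \<bullet> v)) (at x within S)"
proof -
  have "((\<lambda>x. norm x - 1) has_derivative (\<lambda>v. sgn x \<bullet> v)) (at x within S)"
    using has_derivative_diff[OF has_derivative_norm[OF x(2)] has_derivative_const[of 1]]
    by (simp add: inner_commute has_derivative_at_withinI)
  moreover have "(a has_derivative (*) a') (at (norm x - 1) within (\<lambda>x. norm x - 1) ` S)"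
    using a S by (meson has_derivative_subset has_field_derivative_def)
  ultimately have "((\<lambda>x. a (norm x - 1)) has_derivative (\<lambda>v. a' * (sgn x \<bullet> v))) (at x within S)"
    by (rule has_derivative_in_compose)
  from has_derivative_mult[OF this has_derivative_at_withinI[OF Y_deriv[OF x(2)]]]
  show ?thesis by (simp add: inner_add_left algebra_simps)
qed

lemma gradient_separated:
  assumes x: "x \<noteq> 0" and h: "h (norm x - 1) > 0"
    and a: "(a has_real_derivative a') (at (norm x - 1))"
  shows "riemannian_gradient (pullback_metric (revolution_metric h)) (\<lambda>x. a (norm x - 1) * Y x) x =
     (a' * Y x) *\<^sub>R sgn x + (a (norm x - 1) * (norm x / h (norm x - 1))\<^sup>2) *\<^sub>R Z x"
proof -
  let ?c = "(h (norm x - 1) / norm x)\<^sup>2"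
  have c: "?c \<noteq> 0" "1 / ?c = (norm x / h (norm x - 1))\<^sup>2"
    using x h by (auto simp: power_divide)
  have u: "norm (sgn x) = 1" using x by (simp add: norm_sgn)
  have uZ: "sgn x \<bullet> Z x = 0"
    using Z_orthogonal[OF x] by (simp add: sgn_div_norm inner_commute)
  have "(\<chi> j. partial j (\<lambda>x. a (norm x - 1) * Y x) x) = (a' * Y x) *\<^sub>R sgn x + a (norm x - 1) *\<^sub>R Z x"
    using partial_eq[OF separated_has_derivative[OF UNIV_I x subset_UNIV a]]
    by (simp add: vec_eq_iff inner_axis)
  then show ?thesis
    unfolding riemannian_gradient_def pullback_revolution_metric[OF x]
      matrix_inv_radial_matrix[OF u c(1)] radial_matrix_vector c(2)
    using u uZ by (simp add: inner_add_right norm_eq_1 algebra_simps)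
qed

text \<open>Writing the radial equation as a system in \<open>a\<close> and its flux w = h^(n-1) a'
  avoids second derivatives: the weighted gradient contains \<open>w\<close> itself, which is
  differentiated once.\<close>

lemma laplace_separated:
  assumes n: "CARD('n) \<ge> 3" and x: "norm x - 1 \<in> {0<..<L}"
    and h: "\<And>r. r \<in> {0<..<L} \<Longrightarrow> h r > 0"
    and h': "\<And>r. r \<in> {0<..<L} \<Longrightarrow> (h has_real_derivative h' r) (at r)"
    and a: "\<And>r. r \<in> {0<..<L} \<Longrightarrow> (a has_real_derivative w r / h r ^ (CARD('n) - 1)) (at r)"
    and w: "\<And>r. r \<in> {0<..<L} \<Longrightarrow> (w has_real_derivative lam * h r ^ (CARD('n) - 3) * a r) (at r)"
  shows "laplace_beltrami (pullback_metric (revolution_metric h)) (\<lambda>x. a (norm x - 1) * Y x) x = 0"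
proof -
  obtain N where N: "CARD('n) = N + 3" using n by (metis add.commute le_Suc_ex)
  let ?G = "pullback_metric (revolution_metric h) :: real^'n \<Rightarrow> real^'n^'n"
  let ?f = "\<lambda>x. a (norm x - 1) * Y x"
  let ?X = "riemannian_gradient ?G ?f"
  \<comment> \<open>The volume density is (h/t)^(N+2). In the radial part its powers of
    \<open>h\<close> cancel those in a' = w / h^(N+2), and one more 1/t comes from normalising the
    position vector. In the tangential part the inverse metric (t/h)^2 lowers the power to
    N.\<close>
  define \<alpha> where "\<alpha> t = w (t - 1) / t ^ (N + 3)" for t
  define \<beta> where "\<beta> t = (h (t - 1) / t) ^ N * a (t - 1)" for t
  define U where "U = {y::real^'n. norm y - 1 \<in> {0<..<L}}"
  have "open U"
    unfolding U_def greaterThanLessThan_iff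
    by (intro open_Collect_conj open_Collect_less continuous_intros)
  have field: "sqrt (det (?G y)) * ?X y $ i = \<alpha> (norm y) * Y y * y $ i + \<beta> (norm y) * Z y $ i"
    if "y \<in> U" for y i
  proof -
    let ?r = "norm y - 1"
    have r: "?r \<in> {0<..<L}" using that by (simp add: U_def)
    then have y: "y \<noteq> 0" "norm y > 0" by auto
    have "norm (sgn y) = 1" using y by (simp add: norm_sgn)
    then have "det (?G y) = ((h ?r / norm y)\<^sup>2) ^ (CARD('n) - 1)"
      unfolding pullback_revolution_metric[OF y(1)] by (rule det_radial_matrix)
    also have "CARD('n) - 1 = N + 2" by (simp add: N)
    also have "((h ?r / norm y)\<^sup>2) ^ (N + 2) = ((h ?r / norm y) ^ (N + 2))\<^sup>2"
      by (simp only: power_mult[symmetric] mult.commute)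
    finally have "det (?G y) = ((h ?r / norm y) ^ (N + 2))\<^sup>2" .
    then have d: "sqrt (det (?G y)) = (h ?r / norm y) ^ (N + 2)"
      using h[OF r] y by (simp only: real_sqrt_abs) (simp add: zero_le_power)
    have X: "?X y $ i = w ?r / h ?r ^ (N + 2) * Y y * (y $ i / norm y)
        + a ?r * (norm y / h ?r)\<^sup>2 * Z y $ i"
      using gradient_separated[of y h a, OF y(1) h[OF r] a[OF r]]
      by (simp add: N sgn_div_norm divide_inverse mult_ac)
    have p: "h ?r > 0" by (rule h[OF r])
    show ?thesis
      unfolding d X \<alpha>_def \<beta>_def using p y(2)
      by (simp add: field_simps power_add power2_eq_square power3_eq_cube)
  qed
  have x0: "x \<noteq> 0" "norm x > 0" and xU: "x \<in> U" using x by (auto simp: U_def)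
  have sh: "((\<lambda>t. g (t - 1)) has_real_derivative g') (at (norm x))"
    if "(g has_real_derivative g') (at (norm x - 1))" for g g'
    using DERIV_shift[of g g' "norm x" "- 1"] that by simp
  have al: "(\<alpha> has_real_derivative
      lam * h (norm x - 1) ^ N * a (norm x - 1) / norm x ^ (N + 3) - (N + 3) * w (norm x - 1) / norm x ^ (N + 4))
      (at (norm x))"
  proof -
    have "((\<lambda>t. t ^ (N + 3)) has_real_derivative (N + 3) * norm x ^ (N + 2)) (at (norm x))"
      by (rule DERIV_cong[OF DERIV_pow]) simp
    then show ?thesis
      unfolding \<alpha>_def
      by (rule DERIV_cong[OF DERIV_divide[OF sh[OF w[OF x]]]])
        (use x0 in \<open>simp_all add: N field_simps power_add eval_nat_numeral\<close>)
  qed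
  \<comment> \<open>Only existence matters: the gradient of this factor is radial, hence orthogonal
    to \<open>Z\<close>, and its value drops out of the divergence.\<close>
  have be: "\<exists>b. (\<beta> has_real_derivative b) (at (norm x))"
    unfolding \<beta>_def using x0 sh[OF h'[OF x]] sh[OF a[OF x]]
    by (intro exI) (auto intro!: derivative_eq_intros)
  then obtain b where be: "(\<beta> has_real_derivative b) (at (norm x))" ..
  have "(\<Sum>i\<in>UNIV. partial i (\<lambda>y. sqrt (det (?G y)) * ?X y $ i) x)
      = (\<Sum>i\<in>UNIV. partial i (\<lambda>y. \<alpha> (norm y) * Y y * y $ i + \<beta> (norm y) * Z y $ i) x)"
    by (intro sum.cong partial_cong[OF \<open>open U\<close> xU] field refl)
  also have "\<dots> = 0"
    unfolding divergence_radial_field[OF x0(1) al be] unfolding \<alpha>_def \<beta>_def N using x0(2)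
    by (simp add: field_simps power_add) (simp add: eval_nat_numeral field_simps)
  finally show ?thesis
    unfolding laplace_beltrami_def riemannian_divergence_def by simp
qed

end

subsection \<open>The boundary of the shell\<close>

lemma interior_shell: "interior (shell L :: (real^'n) set) = {x. 1 < norm x \<and> norm x < 1 + L}"
proof -
  have "shell L = - ball 0 1 \<inter> cball (0::real^'n) (1 + L)"
    by (auto simp: shell_def)
  then have "interior (shell L :: (real^'n) set) = - cball 0 1 \<inter> ball 0 (1 + L)"
    by (simp add: interior_complement)
  then show ?thesis by (simp add: set_eq_iff not_le)
qed

lemma frontier_shell: "frontier (shell L :: (real^'n) set) = {x \<in> shell L. norm x = 1 \<or> norm x = 1 + L}"
proof -
  have "shell L = - ball 0 1 \<inter> cball (0::real^'n) (1 + L)"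
    by (auto simp: shell_def)
  then have "closed (shell L :: (real^'n) set)" by (simp only: closed_Int closed_Compl open_ball closed_cball)
  then have "frontier (shell L :: (real^'n) set) = shell L - interior (shell L)"
    by (simp only: frontier_def closure_closed)
  then show ?thesis
    by (simp only: interior_shell) (simp add: shell_def set_eq_iff, smt (verit))
qed

text \<open>The line x + t v is projected radially onto the sphere. It misses the origin because its
  inner product with \<open>x\<close> is constant, and since \<open>v\<close> is orthogonal to
  \<open>x\<close> the norm has derivative 0 at t = 0, so the projection does not alter the
  velocity.\<close>

lemma tangent_vectors_sphere:
  assumes x: "x \<in> S" "x \<noteq> 0" and S: "\<And>y. norm y = norm x \<Longrightarrow> y \<in> S" and v: "v \<bullet> x = 0"
  shows "v \<in> tangent_vectors S x"
proof -
  define \<gamma> where "\<gamma> t = (norm x / norm (x + t *\<^sub>R v)) *\<^sub>R (x + t *\<^sub>R v)" for t :: real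
  have nz: "x + t *\<^sub>R v \<noteq> 0" for t
  proof
    assume "x + t *\<^sub>R v = 0"
    then have "(x + t *\<^sub>R v) \<bullet> x = 0" by simp
    with v x show False by (simp add: inner_add_left)
  qed
  have g: "((\<lambda>t. x + t *\<^sub>R v) has_derivative (\<lambda>t. t *\<^sub>R v)) (at 0)"
    by (auto intro!: derivative_eq_intros)
  have n: "(norm has_derivative (\<lambda>w. w \<bullet> sgn x)) (at (x + 0 *\<^sub>R v))"
    using has_derivative_norm[OF x(2)] by simp
  have "((\<lambda>t. norm (x + t *\<^sub>R v)) has_derivative (\<lambda>t. (t *\<^sub>R v) \<bullet> sgn x)) (at 0)"
    by (rule has_derivative_compose[OF g n])
  then have n': "((\<lambda>t. norm (x + t *\<^sub>R v)) has_real_derivative 0) (at 0)"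
    unfolding has_field_derivative_def
    by (rule has_derivative_eq_rhs) (use v in \<open>simp add: fun_eq_iff sgn_div_norm\<close>)
  have "((\<lambda>t. norm x / norm (x + t *\<^sub>R v)) has_real_derivative 0) (at 0)"
    using DERIV_divide[OF DERIV_const n', of "norm x"] x(2) by simp
  moreover have "((\<lambda>t. x + t *\<^sub>R v) has_vector_derivative v) (at 0)"
    using g by (simp add: has_vector_derivative_def)
  ultimately have "(\<gamma> has_vector_derivative v) (at 0)"
    using has_vector_derivative_scaleR[of "\<lambda>t. norm x / norm (x + t *\<^sub>R v)" 0 0 UNIV "\<lambda>t. x + t *\<^sub>R v" v] x(2)
    unfolding \<gamma>_def by simp
  moreover have "\<gamma> t \<in> S" for t
    using nz[of t] by (intro S) (simp add: \<gamma>_def)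
  moreover have "\<gamma> 0 = x" using x(2) by (simp add: \<gamma>_def)
  ultimately show ?thesis unfolding tangent_vectors_def by blast
qed

lemma outward_unit_normal_shell:
  fixes x \<nu> :: "real^'n"
  assumes L: "L > 0" and h: "h 0 = 1" "h L = 1" and x: "x \<in> frontier (shell L)"
    and out: "outward_unit_normal (shell L) (pullback_metric (revolution_metric h)) x \<nu>"
  shows "(norm x = 1 \<and> \<nu> = - sgn x) \<or> (norm x = 1 + L \<and> \<nu> = sgn x)"
proof -
  let ?u = "sgn x" and ?c = "(h (norm x - 1) / norm x)\<^sup>2"
  have nx: "norm x = 1 \<or> norm x = 1 + L" using x by (auto simp: frontier_shell)
  then have x0: "x \<noteq> 0" using L by auto
  then have c: "?c > 0" using nx h by auto
  have u: "?u \<bullet> ?u = 1" using x0 by (simp add: norm_eq_1[symmetric] norm_sgn)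
  define c where "c = ?c"
  note o = out[unfolded outward_unit_normal_def pullback_revolution_metric[OF x0] radial_matrix_vector,
      folded c_def]
  \<comment> \<open>The tangential part of \<nu> is itself a tangent vector of the sphere. Testing
    the normality of \<nu> against it shows that it vanishes.\<close>
  define v where "v = \<nu> - (?u \<bullet> \<nu>) *\<^sub>R ?u"
  have uv: "?u \<bullet> v = 0" using u by (simp add: v_def inner_diff_right)
  then have "v \<bullet> x = 0" using x0 by (simp add: sgn_div_norm inner_commute)
  then have "v \<in> tangent_vectors (frontier (shell L)) x"
    unfolding frontier_shell using x[unfolded frontier_shell] x0 nx
    by (intro tangent_vectors_sphere) (auto simp: shell_def)
  then have "v \<bullet> (c *\<^sub>R \<nu> + ((1 - c) * (?u \<bullet> \<nu>)) *\<^sub>R ?u) = 0"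
    using o[THEN conjunct2, THEN conjunct1] by (rule bspec[rotated])
  then have "v \<bullet> \<nu> = 0"
    using c uv by (simp add: inner_add_right inner_commute[of v ?u] c_def)
  then have "v \<bullet> v = 0"
    using uv by (subst (2) v_def) (simp add: inner_diff_right inner_commute[of _ ?u])
  then have \<nu>: "\<nu> = (?u \<bullet> \<nu>) *\<^sub>R ?u" by (simp add: v_def)
  define k where "k = ?u \<bullet> \<nu>"
  have \<nu>k: "\<nu> = k *\<^sub>R ?u" unfolding k_def by (rule \<nu>)
  have "k * k = 1"
    using o[THEN conjunct1] u unfolding \<nu>k by (simp add: inner_add_right algebra_simps)
  then have k: "k = 1 \<or> k = -1" by (simp only: square_eq_1_iff)
  have ev: "eventually (\<lambda>t. x + t *\<^sub>R \<nu> \<notin> shell L) (at_right 0)"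
    using o[THEN conjunct2, THEN conjunct2] .
  have nm: "norm (x + t *\<^sub>R \<nu>) = \<bar>norm x + t * k\<bar>" for t
  proof -
    have "x + t *\<^sub>R \<nu> = (norm x + t * k) *\<^sub>R ?u"
      using x0 by (simp add: \<nu>k sgn_div_norm algebra_simps)
    then show ?thesis using x0 by (simp add: norm_sgn)
  qed
  \<comment> \<open>For t below L the wrong sign of \<open>k\<close> would move the point into the
    shell, contradicting the outward condition.\<close>
  have "eventually (\<lambda>t. t \<in> {0<..<min 1 L}) (at_right (0::real))"
    using L by (intro eventually_at_right_real) auto
  with ev have "eventually (\<lambda>t. t \<in> {0<..<min 1 L} \<and> x + t *\<^sub>R \<nu> \<notin> shell L) (at_right (0::real))"
    by eventually_elim auto
  then obtain t where t: "t > 0" "t < 1" "t < L" "\<not> (1 \<le> \<bar>norm x + t * k\<bar> \<and> \<bar>norm x + t * k\<bar> \<le> 1 + L)"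
    using eventually_happens'[OF trivial_limit_at_right_real] by (auto simp: shell_def nm)
  then show ?thesis using nx k \<nu>k by auto
qed

subsection \<open>Separated eigenfunctions\<close>

lemma profileD:
  assumes "profile L h" "L > 0"
  shows "smooth_on {0..L} h" "\<And>r. r \<in> {0..L} \<Longrightarrow> h r > 0" "h 0 = 1" "h L = 1"
    "\<exists>h'. \<forall>r\<in>{0..L}. (h has_real_derivative h' r) (at r within {0..L}) \<and> \<bar>h' r\<bar> \<le> 1"
  using assms unfolding profile_def by auto

text \<open>Since \<open>h\<close> is 1 at both ends, the flux \<open>w\<close> equals a' there.
  With the outward normals pointing along -r at 0 and along r at L, the two equations
  \<open>bc\<close> are exactly the Steklov conditions.\<close>

lemma (in angular_eigenfunction) separated_steklov_eigenfunction:
  assumes n: "CARD('n) \<ge> 3" and L: "L > 0" and h: "profile L h"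
    and a: "\<And>r. r \<in> {0..L} \<Longrightarrow>
        (a has_real_derivative inverse (h r ^ (CARD('n) - 1)) * w r) (at r within {0..L})"
    and w: "\<And>r. r \<in> {0..L} \<Longrightarrow>
        (w has_real_derivative (lam * h r ^ (CARD('n) - 3)) * a r) (at r within {0..L})"
    and bc: "- w 0 = \<sigma> * a 0" "w L = \<sigma> * a L"
  shows "(\<lambda>x. a (norm x - 1) * Y x) \<in>
    steklov_eigenspace (shell L) (pullback_metric (revolution_metric h)) \<sigma>"
proof -
  let ?f = "\<lambda>x::real^'n. a (norm x - 1) * Y x"
  note hD = profileD[OF h L]
  have sub: "(\<lambda>x. norm x - 1) ` (shell L :: (real^'n) set) \<subseteq> {0..L}"
    by (auto simp: shell_def)
  have z: "0 \<notin> (shell L :: (real^'n) set)" by (simp add: shell_def)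
  have hk: "Ck_on k {0..L} h" for k using hD(1) by (simp add: smooth_on_def)
  have ak: "Ck_on k {0..L} a" for k
  proof (rule Ck_on_linear_system[of "{0..L}" a _ w, THEN conjunct1])
    show "Ck_on k {0..L} (\<lambda>r. inverse (h r ^ (CARD('n) - 1)))" for k
      using hD(2) by (intro Ck_on_inverse Ck_on_power hk) force
    show "Ck_on k {0..L} (\<lambda>r. lam * h r ^ (CARD('n) - 3))" for k
      by (intro Ck_on_mult Ck_on_const Ck_on_power hk)
  qed (use a w in auto)
  have "Ck_on k (shell L) (\<lambda>x::real^'n. norm x + - 1)" for k
    by (intro Ck_on_add Ck_on_norm z Ck_on_const)
  then have "Ck_on k (shell L) (\<lambda>x::real^'n. norm x - 1)" for k
    by simp
  then have smooth: "smooth_on (shell L) ?f"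
    unfolding smooth_on_def by (intro allI Ck_on_mult Ck_on_compose[OF ak] Y_Ck z sub) auto
  have laplace: "laplace_beltrami (pullback_metric (revolution_metric h)) ?f x = 0"
    if "x \<in> interior (shell L)" for x
  proof -
    obtain h' where h': "\<forall>r\<in>{0..L}. (h has_real_derivative h' r) (at r within {0..L})"
      using hD(5) by blast
    show ?thesis
    proof (rule laplace_separated[OF n, of x L h h' a w])
      show "norm x - 1 \<in> {0<..<L}" using that by (auto simp: interior_shell)
    next
      fix r assume r: "r \<in> {0<..<L}"
      then have [simp]: "at r within {0..L} = at r" by (simp add: at_within_Icc_at)
      have "r \<in> {0..L}" using r by auto
      from h'[rule_format, OF this] a[OF this] w[OF this] hD(2)[OF this]
      show "h r > 0" "(h has_real_derivative h' r) (at r)"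
        "(a has_real_derivative w r / h r ^ (CARD('n) - 1)) (at r)"
        "(w has_real_derivative lam * h r ^ (CARD('n) - 3) * a r) (at r)"
        by (auto simp: divide_inverse mult.commute)
    qed
  qed
  have "\<exists>D. (?f has_derivative D) (at x within shell L) \<and> D \<nu> = \<sigma> * ?f x"
    if x: "x \<in> frontier (shell L)"
      and \<nu>: "outward_unit_normal (shell L) (pullback_metric (revolution_metric h)) x \<nu>" for x \<nu>
  proof -
    have xS: "x \<in> shell L" using x by (simp add: frontier_shell)
    then have x0: "x \<noteq> 0" using z by auto
    have r: "norm x - 1 \<in> {0..L}" using xS by (auto simp: shell_def)
    have u: "sgn x \<bullet> sgn x = 1" using x0 by (simp add: norm_eq_1[symmetric] norm_sgn)
    have Zu: "Z x \<bullet> sgn x = 0" using Z_orthogonal[OF x0] by (simp add: sgn_div_norm)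
    have b0: "- (w 0 * Y x) = \<sigma> * (a 0 * Y x)"
      using bc(1) by (metis mult.assoc mult_minus_left)
    show ?thesis
    proof (rule exI, rule conjI, rule separated_has_derivative[OF xS x0 sub a[OF r]])
      show "(((inverse (h (norm x - 1) ^ (CARD('n) - 1)) * w (norm x - 1)) * Y x) *\<^sub>R sgn x
          + a (norm x - 1) *\<^sub>R Z x) \<bullet> \<nu> = \<sigma> * (a (norm x - 1) * Y x)"
        using outward_unit_normal_shell[OF L hD(3,4) x \<nu>] bc(2) b0 hD(3,4) u Zu
        by (auto simp: inner_add_left)
    qed
  qed
  then show ?thesis
    unfolding steklov_eigenspace_def harmonic_on_def using smooth laplace by blast
qed

lemma angular_eigenfunction_one:
  "angular_eigenfunction (\<lambda>x::real^'n. 1) (\<lambda>x. 0) (\<lambda>x v. 0) 0"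
  by unfold_locales auto

text \<open>These are the spherical harmonics of degree one. The trace of \<open>Z'\<close> has the
  coefficients -1, -1, -n and 3 of x_i / |x|^3, whose sum -(n - 1) is minus the eigenvalue.\<close>

lemma angular_eigenfunction_coordinate:
  fixes i :: "'n::finite"
  shows "angular_eigenfunction (\<lambda>x. x $ i / norm x)
    (\<lambda>x. axis i 1 /\<^sub>R norm x - (x $ i / norm x ^ 3) *\<^sub>R x)
    (\<lambda>x v. - ((x \<bullet> v) / norm x ^ 3) *\<^sub>R axis i 1 - (v $ i / norm x ^ 3) *\<^sub>R x
        - (x $ i / norm x ^ 3) *\<^sub>R v + (3 * x $ i * (x \<bullet> v) / norm x ^ 5) *\<^sub>R x)
    (real CARD('n) - 1)"
proof
  fix x :: "real^'n" assume x: "x \<noteq> 0"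
  then have n0: "norm x \<noteq> 0" by simp
  have n: "(norm has_derivative (\<lambda>v. (x \<bullet> v) / norm x)) (at x)"
    using has_derivative_norm[OF x] by (simp add: inner_commute sgn_div_norm divide_inverse mult.commute)
  have c: "((\<lambda>y. y $ i) has_derivative (\<lambda>v. v $ i)) (at x)"
    by (intro bounded_linear_imp_has_derivative bounded_linear_vec_nth)
  show "((\<lambda>x. x $ i / norm x) has_derivative
      (\<lambda>v. (axis i 1 /\<^sub>R norm x - (x $ i / norm x ^ 3) *\<^sub>R x) \<bullet> v)) (at x)"
    by (rule has_derivative_eq_rhs[OF has_derivative_divide'[OF c n n0]])
      (use n0 in \<open>auto simp: fun_eq_iff inner_diff_left inner_axis' field_simps power3_eq_cube\<close>)
  have i1: "((\<lambda>x::real^'n. 1 / norm x) has_derivative (\<lambda>v. - ((x \<bullet> v) / norm x ^ 3))) (at x)"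
    by (rule has_derivative_eq_rhs[OF has_derivative_divide'[OF has_derivative_const n n0]])
      (use n0 in \<open>auto simp: fun_eq_iff field_simps power3_eq_cube\<close>)
  have p3: "((\<lambda>x. norm x ^ 3) has_derivative (\<lambda>v. 3 * norm x * (x \<bullet> v))) (at x)"
    by (rule has_derivative_eq_rhs[OF has_derivative_power[OF n, of 3]])
      (use n0 in \<open>auto simp: fun_eq_iff field_simps power2_eq_square\<close>)
  have i3: "((\<lambda>x. x $ i / norm x ^ 3) has_derivative
      (\<lambda>v. v $ i / norm x ^ 3 - 3 * x $ i * (x \<bullet> v) / norm x ^ 5)) (at x)"
    by (rule has_derivative_eq_rhs[OF has_derivative_divide'[OF c p3]])
      (use n0 in \<open>auto simp: fun_eq_iff field_simps eval_nat_numeral\<close>)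
  have "((\<lambda>x. (1 / norm x) *\<^sub>R axis i 1 - (x $ i / norm x ^ 3) *\<^sub>R x) has_derivative
      (\<lambda>v. - ((x \<bullet> v) / norm x ^ 3) *\<^sub>R axis i 1 - (v $ i / norm x ^ 3) *\<^sub>R x
        - (x $ i / norm x ^ 3) *\<^sub>R v + (3 * x $ i * (x \<bullet> v) / norm x ^ 5) *\<^sub>R x)) (at x)"
    by (rule has_derivative_eq_rhs[OF has_derivative_diff[OF has_derivative_scaleR[OF i1 has_derivative_const]
        has_derivative_scaleR[OF i3 has_derivative_ident]]])
      (simp add: fun_eq_iff algebra_simps)
  then show "((\<lambda>x. axis i 1 /\<^sub>R norm x - (x $ i / norm x ^ 3) *\<^sub>R x) has_derivative
      (\<lambda>v. - ((x \<bullet> v) / norm x ^ 3) *\<^sub>R axis i 1 - (v $ i / norm x ^ 3) *\<^sub>R x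
        - (x $ i / norm x ^ 3) *\<^sub>R v + (3 * x $ i * (x \<bullet> v) / norm x ^ 5) *\<^sub>R x)) (at x)"
    by (simp add: inverse_eq_divide)
  show "(axis i 1 /\<^sub>R norm x - (x $ i / norm x ^ 3) *\<^sub>R x) \<bullet> x = 0"
    using n0 by (simp add: inner_diff_left inner_axis' power2_norm_eq_inner[symmetric] field_simps eval_nat_numeral)
  have ax: "axis k (1::real) $ j = (if k = j then 1 else 0)" for k j :: 'n
    by (simp add: axis_def)
  have "x $ j * axis i 1 $ j = (if i = j then x $ j else 0)" for j
    by (simp add: ax)
  then have s1: "(\<Sum>j\<in>UNIV. x $ j * axis i 1 $ j) = x $ i"
    by simp
  have s2: "(\<Sum>j\<in>UNIV. x $ j * x $ j) = norm x ^ 2"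
    by (simp add: power2_norm_eq_inner inner_vec_def)
  have "(\<Sum>j\<in>UNIV. (- ((x \<bullet> axis j 1) / norm x ^ 3) *\<^sub>R axis i 1 - (axis j 1 $ i / norm x ^ 3) *\<^sub>R x
        - (x $ i / norm x ^ 3) *\<^sub>R axis j 1 + (3 * x $ i * (x \<bullet> axis j 1) / norm x ^ 5) *\<^sub>R x) $ j)
     = (\<Sum>j\<in>UNIV. (- 2 / norm x ^ 3) * (x $ j * axis i 1 $ j) - x $ i / norm x ^ 3
        + (3 * x $ i / norm x ^ 5) * (x $ j * x $ j))"
    by (rule sum.cong) (auto simp: inner_axis ax field_simps)
  also have "\<dots> = (- 2 / norm x ^ 3) * x $ i - CARD('n) * (x $ i / norm x ^ 3)
        + (3 * x $ i / norm x ^ 5) * norm x ^ 2"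
    unfolding sum.distrib sum_subtractf sum_distrib_left[symmetric] s1 s2 by simp
  also have "\<dots> = - (real CARD('n) - 1) * (x $ i / norm x) / (norm x)\<^sup>2"
    using n0 by (simp add: field_simps eval_nat_numeral)
  finally show "(\<Sum>j\<in>UNIV. (- ((x \<bullet> axis j 1) / norm x ^ 3) *\<^sub>R axis i 1 - (axis j 1 $ i / norm x ^ 3) *\<^sub>R x
        - (x $ i / norm x ^ 3) *\<^sub>R axis j 1 + (3 * x $ i * (x \<bullet> axis j 1) / norm x ^ 5) *\<^sub>R x) $ j)
     = - (real CARD('n) - 1) * (x $ i / norm x) / (norm x)\<^sup>2" .
next
  fix S :: "(real^'n) set" and k assume "0 \<notin> S"
  then have "Ck_on k S (\<lambda>x. (x \<bullet> axis i 1) * inverse (norm x))"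
    by (intro Ck_on_mult Ck_on_inner Ck_on_inverse Ck_on_norm) auto
  then show "Ck_on k S (\<lambda>x. x $ i / norm x)"
    by (simp add: inner_axis divide_inverse)
qed

subsection \<open>The radial differential equation\<close>

lemma deriv_le_imp_diff_le:
  fixes F G :: "real \<Rightarrow> real"
  assumes "c \<le> d"
    and "\<And>r. r \<in> {c..d} \<Longrightarrow> (F has_real_derivative f r) (at r within {c..d})"
    and "\<And>r. r \<in> {c..d} \<Longrightarrow> (G has_real_derivative g r) (at r within {c..d})"
    and "\<And>r. r \<in> {c..d} \<Longrightarrow> g r \<le> f r"
  shows "G d - G c \<le> F d - F c"
proof -
  have "(f has_integral (F d - F c)) {c..d}" "(g has_integral (G d - G c)) {c..d}"
    using assms by (auto intro!: fundamental_theorem_of_calculus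
        simp: has_real_derivative_iff_has_vector_derivative)
  then show ?thesis using assms(4) has_integral_le by blast
qed

text \<open>This produces the strict gap. It is applied with s = m - 1, beyond which the envelope 1
  + t exceeds \<open>m\<close>; the hypothesis m < 1 + L/2 leaves an interval of positive length up
  to L/2.\<close>

lemma deriv_less_imp_diff_less:
  fixes F G :: "real \<Rightarrow> real"
  assumes s: "c \<le> s" "s < d"
    and F: "\<And>r. r \<in> {c..d} \<Longrightarrow> (F has_real_derivative f r) (at r within {c..d})"
    and G: "\<And>r. r \<in> {c..d} \<Longrightarrow> (G has_real_derivative g r) (at r within {c..d})"
    and le: "\<And>r. r \<in> {c..d} \<Longrightarrow> g r \<le> f r"
    and less: "\<And>r. s < r \<Longrightarrow> r < d \<Longrightarrow> g r < f r"
  shows "G d - G c < F d - F c"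
proof -
  have F': "(F has_real_derivative f r) (at r within {c..s})"
    and G': "(G has_real_derivative g r) (at r within {c..s})" if "r \<in> {c..s}" for r
    using F[of r] G[of r] that s by (auto intro: DERIV_subset)
  have "G s - G c \<le> F s - F c"
    using s le by (intro deriv_le_imp_diff_le[OF s(1) F' G']) auto
  moreover have "F s - G s < F d - G d"
  proof (rule DERIV_pos_imp_increasing_open[OF s(2), of "\<lambda>r. F r - G r"])
    fix r assume r: "s < r" "r < d"
    then have [simp]: "at r within {c..d} = at r" using s by (simp add: at_within_Icc_at)
    have "((\<lambda>r. F r - G r) has_real_derivative f r - g r) (at r)"
      using F[of r] G[of r] r s by (auto intro!: derivative_eq_intros)
    then show "\<exists>y. ((\<lambda>r. F r - G r) has_real_derivative y) (at r) \<and> 0 < y"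
      using less[OF r] by (intro exI[of _ "f r - g r"]) auto
  next
    have "continuous_on {c..d} F" "continuous_on {c..d} G"
      by (rule DERIV_continuous_on, rule F, assumption, rule DERIV_continuous_on, rule G, assumption)
    then show "continuous_on {s..d} (\<lambda>r. F r - G r)"
      using s by (intro continuous_on_diff) (auto elim: continuous_on_subset)
  qed
  ultimately show ?thesis by linarith
qed

section \<open>Existence for linear first-order systems by Picard iteration\<close>

lemma integral_has_real_derivative_within:
  fixes f :: "real \<Rightarrow> real"
  assumes "continuous_on {0..L} f" "r \<in> {0..L}"
  shows "((\<lambda>r. integral {0..r} f) has_real_derivative f r) (at r within {0..L})"
  using integral_has_vector_derivative[OF assms]
  by (simp add: has_real_derivative_iff_has_vector_derivative)

text \<open>The equation (p u')' = q u in divergence form, with P = 1/p and the flux w = p u' as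
  second unknown.\<close>

definition solves_linear_system ::
    "real \<Rightarrow> (real \<Rightarrow> real) \<Rightarrow> (real \<Rightarrow> real) \<Rightarrow> (real \<Rightarrow> real) \<Rightarrow> (real \<Rightarrow> real) \<Rightarrow> bool" where
  "solves_linear_system L P q u w \<longleftrightarrow>
     (\<forall>r\<in>{0..L}. (u has_real_derivative P r * w r) (at r within {0..L}) \<and>
                 (w has_real_derivative q r * u r) (at r within {0..L}))"

text \<open>These are the increments of the Picard iteration, not the iterates; the solution is
  their sum.\<close>

primrec picard_term ::
    "(real \<Rightarrow> real) \<Rightarrow> (real \<Rightarrow> real) \<Rightarrow> real \<Rightarrow> real \<Rightarrow> nat \<Rightarrow> (real \<Rightarrow> real) \<times> (real \<Rightarrow> real)" where
  "picard_term P q \<alpha> \<beta> 0 = (\<lambda>r. \<alpha>, \<lambda>r. \<beta>)"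
| "picard_term P q \<alpha> \<beta> (Suc k) =
     (\<lambda>r. integral {0..r} (\<lambda>t. P t * snd (picard_term P q \<alpha> \<beta> k) t),
      \<lambda>r. integral {0..r} (\<lambda>t. q t * fst (picard_term P q \<alpha> \<beta> k) t))"

text \<open>One half of the system, used twice with the two unknowns exchanged. The factorial bounds
  let the differentiated series pass the Weierstrass test.\<close>

lemma picard_series:
  fixes P q u w :: "real \<Rightarrow> real" and y z :: "nat \<Rightarrow> real \<Rightarrow> real"
  assumes L: "0 \<le> L" and P: "continuous_on {0..L} P" "\<And>r. r \<in> {0..L} \<Longrightarrow> \<bar>P r\<bar> \<le> K"
    and y0: "y 0 = (\<lambda>r. \<alpha>)" and yS: "\<And>k. y (Suc k) = (\<lambda>r. integral {0..r} (\<lambda>t. P t * z k t))"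
    and z: "\<And>k. continuous_on {0..L} (z k)"
      "\<And>k r. r \<in> {0..L} \<Longrightarrow> \<bar>z k r\<bar> \<le> M * (K * L) ^ k / fact k"
  shows "\<exists>u. \<forall>r\<in>{0..L}. (\<lambda>k. y k r) sums u r \<and>
          (u has_real_derivative P r * (\<Sum>k. z k r)) (at r within {0..L})"
proof -
  define y' where "y' k r = (case k of 0 \<Rightarrow> 0 | Suc j \<Rightarrow> P r * z j r)" for k r
  define m where "m k = (case k of 0 \<Rightarrow> 0 | Suc j \<Rightarrow> K * (M * (K * L) ^ j / fact j))" for k
  have K: "0 \<le> K" using P(2)[of 0] L by force
  have "summable (\<lambda>j. (K * L) ^ j /\<^sub>R fact j)" by (rule summable_exp_generic)
  then have "summable (\<lambda>j. K * M * ((K * L) ^ j /\<^sub>R fact j))" by (rule summable_mult)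
  then have "summable (\<lambda>j. m (Suc j))" by (simp add: m_def field_simps)
  then have summ: "summable m" by (simp only: summable_Suc_iff)
  have bound: "norm (y' k r) \<le> m k" if "r \<in> {0..L}" for k r
    using that P(2)[of r] z(2)[of r] K
    by (cases k) (auto simp: y'_def m_def abs_mult intro!: mult_mono simp del: times_divide_eq_right)
  have deriv: "(y k has_real_derivative y' k r) (at r within {0..L})" if "r \<in> {0..L}" for k r
  proof (cases k)
    case 0
    then show ?thesis by (simp add: y0 y'_def)
  next
    case (Suc j)
    then show ?thesis
      using integral_has_real_derivative_within[OF continuous_on_mult[OF P(1) z(1)] that]
      by (simp add: yS y'_def)
  qed
  \<comment> \<open>Termwise differentiation requires convergence at one point; at 0 every integral
    is over a degenerate interval.\<close>
  have y_at_0: "y (Suc k) 0 = 0" for k by (simp add: yS)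
  have "summable (\<lambda>k. y k 0)"
    using summable_finite[of "{0}" "\<lambda>k. y k 0"] y_at_0 by (metis finite.emptyI finite.insertI not0_implies_Suc singletonI)
  then obtain u where u: "\<forall>r\<in>{0..L}. (\<lambda>k. y k r) sums u r \<and>
      (u has_field_derivative (\<Sum>k. y' k r)) (at r within {0..L})"
    using has_field_derivative_series[of "{0..L}" y y' "\<lambda>r. \<Sum>k. y' k r" 0]
      Weierstrass_m_test[of "{0..L}" y' m, OF bound summ] deriv L by auto
  have "(\<Sum>k. y' k r) = P r * (\<Sum>k. z k r)" if r: "r \<in> {0..L}" for r
  proof -
    have "summable (\<lambda>j. M * ((K * L) ^ j /\<^sub>R fact j))"
      by (intro summable_mult summable_exp_generic)
    moreover have "M * ((K * L) ^ j /\<^sub>R fact j) = M * (K * L) ^ j / fact j" for j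
      by (simp add: field_simps)
    ultimately have "summable (\<lambda>j. M * (K * L) ^ j / fact j)" by (simp only:)
    then have "summable (\<lambda>k. z k r)"
      by (rule summable_comparison_test'[of _ 0]) (use z(2)[OF r] in simp)
    then have s: "(\<lambda>k. P r * z k r) sums (P r * (\<Sum>k. z k r))"
      by (intro sums_mult summable_sums)
    have "y' (Suc k) r = P r * z k r" for k by (simp add: y'_def)
    with s have "(\<lambda>k. y' (Suc k) r) sums (P r * (\<Sum>k. z k r))" by simp
    from sums_unique[OF sums_Suc[OF this]] have "(\<Sum>k. y' k r) = P r * (\<Sum>k. z k r) + y' 0 r" by simp
    then show ?thesis by (simp add: y'_def)
  qed
  with u show ?thesis by force
qed

text \<open>The bound involves \<open>r\<close> rather than \<open>L\<close>, because integrating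
  r^k supplies the next factor of the factorial.\<close>

lemma picard_bound:
  fixes P z y :: "real \<Rightarrow> real"
  assumes P: "continuous_on {0..L} P" "\<And>r. r \<in> {0..L} \<Longrightarrow> \<bar>P r\<bar> \<le> K" and z: "continuous_on {0..L} z"
    and zb: "\<And>r. r \<in> {0..L} \<Longrightarrow> \<bar>z r\<bar> \<le> M * (K * r) ^ k / fact k" and r: "r \<in> {0..L}"
  shows "\<bar>integral {0..r} (\<lambda>t. P t * z t)\<bar> \<le> M * (K * r) ^ Suc k / fact (Suc k)"
proof -
  have K: "0 \<le> K" using P(2)[OF r] by linarith
  have I: "((\<lambda>t. K * (M * (K * t) ^ k / fact k)) has_integral
      M * (K * r) ^ Suc k / fact (Suc k) - M * (K * 0) ^ Suc k / fact (Suc k)) {0..r}"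
  proof (rule fundamental_theorem_of_calculus)
    fix t assume "t \<in> {0..r}"
    have "((\<lambda>t. M * (K * t) ^ Suc k / fact (Suc k)) has_real_derivative
        M * (real (Suc k) * (K * t) ^ k * K) / fact (Suc k)) (at t within {0..r})"
      by (intro derivative_eq_intros | simp)+
    also have "M * (real (Suc k) * (K * t) ^ k * K) / fact (Suc k) = K * (M * (K * t) ^ k / fact k)"
      by (simp add: fact_Suc field_simps del: of_nat_Suc)
    finally show "((\<lambda>t. M * (K * t) ^ Suc k / fact (Suc k)) has_vector_derivative K * (M * (K * t) ^ k / fact k)) (at t within {0..r})"
      by (simp only: has_real_derivative_iff_has_vector_derivative)
  qed (use r in auto)
  have "norm (integral {0..r} (\<lambda>t. P t * z t)) \<le> integral {0..r} (\<lambda>t. K * (M * (K * t) ^ k / fact k))"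
  proof (rule integral_norm_bound_integral)
    have "continuous_on {0..r} (\<lambda>t. P t * z t)"
      using P(1) z r by (intro continuous_on_mult) (auto elim: continuous_on_subset)
    then show "(\<lambda>t. P t * z t) integrable_on {0..r}" by (rule integrable_continuous_real)
    fix t assume "t \<in> {0..r}"
    then have "t \<in> {0..L}" using r by auto
    from P(2)[OF this] zb[OF this] K show "norm (P t * z t) \<le> K * (M * (K * t) ^ k / fact k)"
      by (auto simp: abs_mult intro!: mult_mono simp del: times_divide_eq_right)
  qed (use I in blast)
  then show ?thesis using integral_unique[OF I] by simp
qed

text \<open>For nonnegative data all increments are nonnegative, so \<open>w\<close> dominates its
  zeroth term \<beta>. This last clause serves to show that the solution with initial value 0 and
  initial flux 1 is positive at L.\<close>

lemma linear_system_solution: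
  fixes P q :: "real \<Rightarrow> real"
  assumes L: "0 \<le> L" and P: "continuous_on {0..L} P" and q: "continuous_on {0..L} q"
  obtains u w where "solves_linear_system L P q u w" "u 0 = \<alpha>" "w 0 = \<beta>"
    "\<lbrakk>\<And>r. r \<in> {0..L} \<Longrightarrow> 0 \<le> P r; \<And>r. r \<in> {0..L} \<Longrightarrow> 0 \<le> q r; 0 \<le> \<alpha>; 0 \<le> \<beta>\<rbrakk> \<Longrightarrow>
       \<forall>r\<in>{0..L}. \<beta> \<le> w r"
proof -
  let ?t = "picard_term P q \<alpha> \<beta>"
  define y where "y k = fst (?t k)" for k
  define z where "z k = snd (?t k)" for k
  have y0: "y 0 = (\<lambda>r. \<alpha>)" and z0: "z 0 = (\<lambda>r. \<beta>)"
    and yS: "y (Suc k) = (\<lambda>r. integral {0..r} (\<lambda>t. P t * z k t))"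
    and zS: "z (Suc k) = (\<lambda>r. integral {0..r} (\<lambda>t. q t * y k t))" for k
    by (simp_all add: y_def z_def)
  obtain K1 K2 where "\<And>r. r \<in> {0..L} \<Longrightarrow> \<bar>P r\<bar> \<le> K1" "\<And>r. r \<in> {0..L} \<Longrightarrow> \<bar>q r\<bar> \<le> K2"
    using continuous_on_compact_bound[OF compact_Icc P] continuous_on_compact_bound[OF compact_Icc q]
    by (metis real_norm_def)
  then obtain K where KP: "\<bar>P r\<bar> \<le> K" and Kq: "\<bar>q r\<bar> \<le> K" if "r \<in> {0..L}" for r
    by (metis (no_types) max.coboundedI1 max.coboundedI2)
  have K: "0 \<le> K" using KP[of 0] L by force
  define M where "M = \<bar>\<alpha>\<bar> + \<bar>\<beta>\<bar>"
  have cont: "continuous_on {0..L} (y k) \<and> continuous_on {0..L} (z k)" for k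
  proof (induction k)
    case (Suc k)
    then have "continuous_on {0..L} (\<lambda>t. P t * z k t)" "continuous_on {0..L} (\<lambda>t. q t * y k t)"
      using P q by (auto intro: continuous_on_mult)
    then show ?case
      unfolding yS zS by (intro conjI indefinite_integral_continuous_1 integrable_continuous_real)
  qed (simp add: y0 z0)
  have b: "\<forall>r\<in>{0..L}. \<bar>y k r\<bar> \<le> M * (K * r) ^ k / fact k \<and> \<bar>z k r\<bar> \<le> M * (K * r) ^ k / fact k" for k
  proof (induction k)
    case (Suc k)
    then show ?case
      unfolding yS zS using P q KP Kq cont by (intro ballI conjI picard_bound[of L]) auto
  qed (simp add: y0 z0 M_def)
  have "M * (K * r) ^ k / fact k \<le> M * (K * L) ^ k / fact k" if "r \<in> {0..L}" for k r
    using that K by (intro divide_right_mono mult_left_mono power_mono) (auto simp: M_def)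
  with b have bL: "\<bar>y k r\<bar> \<le> M * (K * L) ^ k / fact k" "\<bar>z k r\<bar> \<le> M * (K * L) ^ k / fact k"
    if "r \<in> {0..L}" for k r using that by (meson order_trans)+
  obtain u where u: "\<And>r. r \<in> {0..L} \<Longrightarrow> (\<lambda>k. y k r) sums u r"
    "\<And>r. r \<in> {0..L} \<Longrightarrow> (u has_real_derivative P r * (\<Sum>k. z k r)) (at r within {0..L})"
    using picard_series[OF L P KP y0 yS _ bL(2)] cont by metis
  obtain w where w: "\<And>r. r \<in> {0..L} \<Longrightarrow> (\<lambda>k. z k r) sums w r"
    "\<And>r. r \<in> {0..L} \<Longrightarrow> (w has_real_derivative q r * (\<Sum>k. y k r)) (at r within {0..L})"
    using picard_series[OF L q Kq z0 zS _ bL(1)] cont by metis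
  show ?thesis
  proof
    show "solves_linear_system L P q u w"
      unfolding solves_linear_system_def using u w sums_unique by metis
    have "(\<lambda>k. y k 0) sums \<alpha>" "(\<lambda>k. z k 0) sums \<beta>"
      using sums_Suc[of "\<lambda>k. y k 0" 0] sums_Suc[of "\<lambda>k. z k 0" 0] by (simp_all add: y0 z0 yS zS)
    then show "u 0 = \<alpha>" "w 0 = \<beta>"
      using u(1)[of 0] w(1)[of 0] L sums_unique2 by auto
  next
    assume nn: "\<And>r. r \<in> {0..L} \<Longrightarrow> 0 \<le> P r" "\<And>r. r \<in> {0..L} \<Longrightarrow> 0 \<le> q r" "0 \<le> \<alpha>" "0 \<le> \<beta>"
    have pos: "\<forall>r\<in>{0..L}. 0 \<le> y k r \<and> 0 \<le> z k r" for k
    proof (induction k)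
      case (Suc k)
      have "0 \<le> integral {0..r} (\<lambda>t. P t * z k t) \<and> 0 \<le> integral {0..r} (\<lambda>t. q t * y k t)"
        if "r \<in> {0..L}" for r
        using Suc nn that by (intro conjI integral_nonneg integrable_continuous_real continuous_on_mult
            continuous_on_subset[OF P] continuous_on_subset[OF q]
            continuous_on_subset[OF cont[THEN conjunct1]] continuous_on_subset[OF cont[THEN conjunct2]]) auto
      then show ?case by (simp add: yS zS)
    qed (use nn in \<open>simp add: y0 z0\<close>)
    show "\<forall>r\<in>{0..L}. \<beta> \<le> w r"
    proof
      fix r assume r: "r \<in> {0..L}"
      have "sum (\<lambda>k. z k r) {0} \<le> (\<Sum>k. z k r)"
        using w(1)[OF r] pos r by (intro sum_le_suminf) (auto simp: sums_iff)
      then show "\<beta> \<le> w r" using w(1)[OF r] by (simp add: z0 sums_iff)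
    qed
  qed
qed

lemma solves_linear_systemD:
  assumes "solves_linear_system L P q u w" "r \<in> {0..L}"
  shows "(u has_real_derivative P r * w r) (at r within {0..L})"
    "(w has_real_derivative q r * u r) (at r within {0..L})"
  using assms by (auto simp: solves_linear_system_def)

section \<open>Boundary values, fluxes and the Dirichlet principle\<close>

lemma solves_linear_system_combine:
  assumes "solves_linear_system L P q u w" "solves_linear_system L P q u' w'"
  shows "solves_linear_system L P q (\<lambda>r. a * u r + b * u' r) (\<lambda>r. a * w r + b * w' r)"
  unfolding solves_linear_system_def
proof (intro ballI conjI)
  fix r assume r: "r \<in> {0..L}"
  note D = solves_linear_systemD[OF assms(1) r] solves_linear_systemD[OF assms(2) r]
  show "((\<lambda>r. a * u r + b * u' r) has_real_derivative P r * (a * w r + b * w' r)) (at r within {0..L})"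
    by (rule DERIV_cong[OF DERIV_add[OF DERIV_cmult[OF D(1)] DERIV_cmult[OF D(3)]]]) (simp add: algebra_simps)
  show "((\<lambda>r. a * w r + b * w' r) has_real_derivative q r * (a * u r + b * u' r)) (at r within {0..L})"
    by (rule DERIV_cong[OF DERIV_add[OF DERIV_cmult[OF D(2)] DERIV_cmult[OF D(4)]]]) (simp add: algebra_simps)
qed

text \<open>Conservation of the Wronskian expresses the symmetry of the map from boundary values to
  outward fluxes.\<close>

lemma wronskian_const:
  assumes "0 \<le> L" "solves_linear_system L P q u w" "solves_linear_system L P q u' w'"
  shows "u L * w' L - w L * u' L = u 0 * w' 0 - w 0 * u' 0"
proof -
  have "((\<lambda>r. u r * w' r - w r * u' r) has_real_derivative 0) (at r within {0..L})" if r: "r \<in> {0..L}" for r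
  proof -
    note D = solves_linear_systemD[OF assms(2) r] solves_linear_systemD[OF assms(3) r]
    show ?thesis
      by (rule DERIV_cong[OF DERIV_diff[OF DERIV_mult[OF D(1,4)] DERIV_mult[OF D(2,3)]]]) (simp add: algebra_simps)
  qed
  then have "((\<lambda>r. 0) has_integral (u L * w' L - w L * u' L) - (u 0 * w' 0 - w 0 * u' 0)) {0..L}"
    using assms(1) fundamental_theorem_of_calculus[of 0 L "\<lambda>r. u r * w' r - w r * u' r" "\<lambda>r. 0"]
    by (simp add: has_real_derivative_iff_has_vector_derivative)
  then show ?thesis using has_integral_unique[OF has_integral_0] by fastforce
qed

text \<open>The boundary values of a solution determine its boundary fluxes by a symmetric two by two
  matrix. \<open>\<sigma>\<close> is its smaller eigenvalue, and \<open>v L - v 0\<close> is the value of its quadratic form at (1, 1).\<close>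

lemma two_point_steklov:
  fixes P q :: "real \<Rightarrow> real"
  assumes L: "0 < L" and P: "continuous_on {0..L} P" and q: "continuous_on {0..L} q"
    and pos: "\<And>r. r \<in> {0..L} \<Longrightarrow> 0 < P r" "\<And>r. r \<in> {0..L} \<Longrightarrow> 0 \<le> q r"
  obtains a w \<sigma> b v where
    "solves_linear_system L P q a w" "a 0 = 1" "- w 0 = \<sigma> * a 0" "w L = \<sigma> * a L"
    "solves_linear_system L P q b v" "b 0 = 1" "b L = 1" "2 * \<sigma> \<le> v L - v 0"
proof -
  have L0: "0 \<le> L" using L by simp
  obtain c wc where c: "solves_linear_system L P q c wc" "c 0 = 1" "wc 0 = 0"
    using linear_system_solution[OF L0 P q] by metis
  obtain s ws where s: "solves_linear_system L P q s ws" "s 0 = 0" "ws 0 = 1"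
    and ws: "\<lbrakk>\<And>r. r \<in> {0..L} \<Longrightarrow> 0 \<le> P r; \<And>r. r \<in> {0..L} \<Longrightarrow> 0 \<le> q r; (0::real) \<le> 0; (0::real) \<le> 1\<rbrakk> \<Longrightarrow>
       \<forall>r\<in>{0..L}. 1 \<le> ws r"
    by (rule linear_system_solution[OF L0 P q, where \<alpha> = 0 and \<beta> = 1]) blast
  have ws1: "1 \<le> ws r" if "r \<in> {0..L}" for r
    using ws pos that by (simp add: less_imp_le)
  have "(0::real) - 0 < s L - s 0"
  proof (rule deriv_less_imp_diff_less[of 0 0 L s "\<lambda>r. P r * ws r" "\<lambda>_. 0" "\<lambda>_. 0"])
    show "0 < P r * ws r" if "0 < r" "r < L" for r
      using pos(1)[of r] ws1[of r] that by simp
    show "0 \<le> P r * ws r" if "r \<in> {0..L}" for r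
      using pos(1)[of r] ws1[of r] that by simp
  qed (use L solves_linear_systemD(1)[OF s(1)] in auto)
  then have S: "0 < s L" using s by simp
  have W: "c L * ws L - wc L * s L = 1"
    using wronskian_const[OF L0 c(1) s(1)] c s by simp
  \<comment> \<open>The combination c - \<sigma> s satisfies the condition at 0. The condition at L
    is then the quadratic equation in \<open>root\<close>, and the Wronskian identity
    \<open>W\<close> turns its discriminant into the expression under the square root. \<sigma> is
    the smaller root.\<close>
  define D where "D = sqrt ((c L - ws L)\<^sup>2 + 4)"
  define \<sigma> where "\<sigma> = (c L + ws L - D) / (2 * s L)"
  have D2: "D\<^sup>2 = (c L - ws L)\<^sup>2 + 4" by (simp add: D_def)
  have "2 * s L * \<sigma> = c L + ws L - D" using S by (simp add: \<sigma>_def)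
  then have "(2 * s L * \<sigma> - (c L + ws L))\<^sup>2 = (c L - ws L)\<^sup>2 + 4" using D2 by simp
  then have "4 * s L * (s L * \<sigma>\<^sup>2 - (c L + ws L) * \<sigma> + wc L) = 0"
    using W by (simp add: power2_eq_square algebra_simps)
  then have root: "s L * \<sigma>\<^sup>2 - (c L + ws L) * \<sigma> + wc L = 0" using S by simp
  \<comment> \<open>Chosen so that c + k s takes the value 1 at both ends.\<close>
  define k where "k = (1 - c L) / s L"
  have kS: "k * s L = 1 - c L" using S by (simp add: k_def)
  \<comment> \<open>This is the comparison of the smallest eigenvalue with the Rayleigh quotient at
    (1, 1): the flux difference of c + k s times \<open>s L\<close> is the numerator of \<sigma>
    with D replaced by 2.\<close>
  have "2 \<le> D" unfolding D_def by (rule real_le_rsqrt) (simp add: power2_eq_square)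
  then have "\<sigma> * s L * 2 \<le> c L + ws L - 2" using S by (simp add: \<sigma>_def)
  moreover have "(wc L + k * ws L - k) * s L = c L + ws L - 2"
  proof -
    have "(wc L + k * ws L - k) * s L = wc L * s L + (ws L - 1) * (k * s L)"
      by (simp add: algebra_simps)
    also have "\<dots> = (c L * ws L - 1) + (ws L - 1) * (1 - c L)"
      using W kS by simp
    finally show ?thesis by (simp add: algebra_simps)
  qed
  ultimately have "(2 * \<sigma>) * s L \<le> (wc L + k * ws L - k) * s L" by simp
  then have le: "2 * \<sigma> \<le> wc L + k * ws L - k"
    using S by (simp only: mult_le_cancel_right_pos)
  show ?thesis
  proof
    show "solves_linear_system L P q (\<lambda>r. 1 * c r + (- \<sigma>) * s r) (\<lambda>r. 1 * wc r + (- \<sigma>) * ws r)"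
      by (rule solves_linear_system_combine[OF c(1) s(1)])
    show "solves_linear_system L P q (\<lambda>r. 1 * c r + k * s r) (\<lambda>r. 1 * wc r + k * ws r)"
      by (rule solves_linear_system_combine[OF c(1) s(1)])
    show "1 * wc L + (- \<sigma>) * ws L = \<sigma> * (1 * c L + (- \<sigma>) * s L)"
      using root by (simp add: power2_eq_square algebra_simps)
  qed (use c s kS le in auto)
qed

text \<open>Integrating the pointwise bound on the derivative of \<open>2 w \<phi> - w a\<close> gives the Dirichlet
  principle: among functions with given boundary values the solution has the least energy.\<close>

lemma dirichlet_calibration:
  fixes p q :: "real \<Rightarrow> real"
  assumes "c \<le> d"
    and a: "\<And>r. r \<in> {c..d} \<Longrightarrow> (a has_real_derivative inverse (p r) * w r) (at r within {c..d})"
    and w: "\<And>r. r \<in> {c..d} \<Longrightarrow> (w has_real_derivative q r * a r) (at r within {c..d})"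
    and \<phi>: "\<And>r. r \<in> {c..d} \<Longrightarrow> (\<phi> has_real_derivative \<phi>' r) (at r within {c..d})"
    and G: "\<And>r. r \<in> {c..d} \<Longrightarrow> (G has_real_derivative g r) (at r within {c..d})"
    and pos: "\<And>r. r \<in> {c..d} \<Longrightarrow> 0 < p r" "\<And>r. r \<in> {c..d} \<Longrightarrow> 0 \<le> q r"
    and le: "\<And>r. r \<in> {c..d} \<Longrightarrow> p r * (\<phi>' r)\<^sup>2 + q r * (\<phi> r)\<^sup>2 \<le> g r"
  shows "(2 * w d * \<phi> d - w d * a d) - (2 * w c * \<phi> c - w c * a c) \<le> G d - G c"
proof (rule deriv_le_imp_diff_le[OF assms(1) G])
  fix r assume r: "r \<in> {c..d}"
  show "((\<lambda>r. 2 * w r * \<phi> r - w r * a r) has_real_derivative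
      2 * (q r * a r) * \<phi> r + 2 * w r * \<phi>' r - q r * (a r)\<^sup>2 - inverse (p r) * (w r)\<^sup>2) (at r within {c..d})"
    by (rule DERIV_cong[OF DERIV_diff[OF DERIV_mult[OF DERIV_cmult[OF w[OF r]] \<phi>[OF r]] DERIV_mult[OF w[OF r] a[OF r]]]])
      (simp add: power2_eq_square algebra_simps)
  have "0 \<le> q r * (\<phi> r - a r)\<^sup>2 + p r * (\<phi>' r - inverse (p r) * w r)\<^sup>2"
    using pos[OF r] by simp
  also have "\<dots> = p r * (\<phi>' r)\<^sup>2 + q r * (\<phi> r)\<^sup>2
      - (2 * (q r * a r) * \<phi> r + 2 * w r * \<phi>' r - q r * (a r)\<^sup>2 - inverse (p r) * (w r)\<^sup>2)"
    using pos(1)[OF r] by (simp add: power2_eq_square field_simps)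
  finally show "2 * (q r * a r) * \<phi> r + 2 * w r * \<phi>' r - q r * (a r)\<^sup>2 - inverse (p r) * (w r)\<^sup>2 \<le> g r"
    using le[OF r] by linarith
qed

subsection \<open>Comparison with the annulus\<close>

lemma has_real_derivative_reflect:
  fixes F :: "real \<Rightarrow> real"
  assumes "(F has_real_derivative f) (at (s - r) within {s - d..s - c})"
  shows "((\<lambda>r. F (s - r)) has_real_derivative - f) (at r within {c..d})"
proof -
  have "((\<lambda>r. s - r) has_real_derivative - 1) (at r within {c..d})"
    by (auto intro!: derivative_eq_intros)
  from DERIV_image_chain[OF _ this, of F f] assms show ?thesis
    by (simp add: o_def)
qed

lemma profile_le:
  assumes "profile L h" "0 < L" "r \<in> {0..L}"
  shows "h r \<le> 1 + r" "h r \<le> 1 + (L - r)"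
proof -
  note h = profileD[OF assms(1,2)]
  obtain h' where h': "\<And>r. r \<in> {0..L} \<Longrightarrow> (h has_real_derivative h' r) (at r within {0..L})"
    "\<And>r. r \<in> {0..L} \<Longrightarrow> \<bar>h' r\<bar> \<le> 1" using h(5) by blast
  have h'_sub: "(h has_real_derivative h' t) (at t within S)" if "t \<in> S" "S \<subseteq> {0..L}" for t S
    using h'(1) that by (meson DERIV_subset subsetD)
  have "h r - h 0 \<le> r - 0"
    by (rule deriv_le_imp_diff_le[of 0 r _ "\<lambda>_. 1" h h'])
      (use assms(3) h'_sub h'(2) in \<open>auto intro!: derivative_eq_intros simp: abs_le_iff\<close>)
  then show "h r \<le> 1 + r" using h(3) by simp
  have "- h L - - h r \<le> L - r"
    by (rule deriv_le_imp_diff_le[of r L _ "\<lambda>_. 1" "\<lambda>t. - h t" "\<lambda>t. - h' t"])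
      (use assms(3) h'_sub h'(2) in \<open>auto intro!: derivative_eq_intros simp: abs_le_iff\<close>)
  then show "h r \<le> 1 + (L - r)" using h(4) by simp
qed

section \<open>Upper bounds for the first nonzero eigenvalue\<close>

lemma constant_steklov_eigenfunction:
  assumes "CARD('n) \<ge> 3" "0 < L" "profile L h"
  shows "(\<lambda>x::real^'n. 1) \<in> steklov_eigenspace (shell L) (pullback_metric (revolution_metric h)) 0"
proof -
  interpret angular_eigenfunction "\<lambda>x::real^'n. 1" "\<lambda>x. 0" "\<lambda>x v. 0" 0
    by (rule angular_eigenfunction_one)
  have "(\<lambda>x::real^'n. (\<lambda>r. 1) (norm x - 1) * 1) \<in>
      steklov_eigenspace (shell L) (pullback_metric (revolution_metric h)) 0"
    by (rule separated_steklov_eigenfunction[OF assms, where w = "\<lambda>r. 0"]) auto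
  then show ?thesis by simp
qed

text \<open>Indices start at 0 and the constants, with eigenvalue 0, occupy the first place. One
  further eigenfunction that takes two different values is independent of them; \<open>t\<close>
  must dominate both eigenvalues.\<close>

lemma steklov_sigma_1_le:
  fixes f :: "real^'n \<Rightarrow> real"
  assumes "CARD('n) \<ge> 3" "0 < L" "profile L h"
    and f: "f \<in> steklov_eigenspace (shell L) (pullback_metric (revolution_metric h)) \<sigma>"
    and t: "\<sigma> \<le> t" "0 \<le> t"
    and xy: "x \<in> shell L" "y \<in> shell L" "f x \<noteq> f y"
  shows "steklov_sigma L (revolution_metric h :: 'n metric) 1 \<le> ereal t"
  unfolding steklov_sigma_def steklov_value_def
proof (rule Inf_lower, rule CollectI, intro exI conjI refl)
  let ?\<sigma> = "\<lambda>i::nat. if i = 0 then 0 else \<sigma>"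
  let ?f = "\<lambda>i::nat. if i = 0 then (\<lambda>x. 1) else f"
  show "\<forall>i\<le>1. ?\<sigma> i \<le> t \<and> ?f i \<in> steklov_eigenspace (shell L) (pullback_metric (revolution_metric h)) (?\<sigma> i)"
    using f t constant_steklov_eigenfunction[OF assms(1-3)] by auto
  have "{..1::nat} = {0, 1}" by auto
  then have "c 0 = 0 \<and> c 1 = 0" if "\<forall>x\<in>shell L. (\<Sum>i\<le>1. c i * ?f i x) = 0" for c :: "nat \<Rightarrow> real"
  proof -
    have e: "c 0 + c 1 * f x = 0" "c 0 + c 1 * f y = 0"
      using that xy \<open>{..1::nat} = {0, 1}\<close> by auto
    have "c 1 * (f x - f y) = (c 0 + c 1 * f x) - (c 0 + c 1 * f y)" by (simp add: algebra_simps)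
    then have "c 1 * (f x - f y) = 0" by (simp only: e diff_self)
    with xy(3) e show ?thesis by auto
  qed
  then show "independent_on (shell L) {..1} ?f"
    unfolding independent_on_def \<open>{..1::nat} = {0, 1}\<close> by auto
qed (rule refl)

lemma profile_powers_continuous:
  assumes "profile L h" "0 < L"
  shows "continuous_on {0..L} (\<lambda>r. inverse (h r ^ k))" "continuous_on {0..L} (\<lambda>r. c * h r ^ k)"
proof -
  note h = profileD[OF assms]
  have "Ck_on 0 {0..L} h" using h(1) unfolding smooth_on_def by blast
  then have c: "continuous_on {0..L} h" by simp
  have "h r ^ k \<noteq> 0" if "r \<in> {0..L}" for r using h(2)[OF that] by simp
  then show "continuous_on {0..L} (\<lambda>r. inverse (h r ^ k))" using c by (intro continuous_intros) auto
  show "continuous_on {0..L} (\<lambda>r. c * h r ^ k)" using c by (intro continuous_intros)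
qed

lemma radial_steklov_bound:
  fixes L m :: real
  assumes n: "CARD('n::finite) = N + 3" and L: "0 < L" and m: "1 \<le> m" "m < 1 + L / 2"
  shows "\<exists>t\<ge>0. t < (real N + 1) * (1 + L / 2) ^ (N + 1) / ((1 + L / 2) ^ (N + 1) - 1) \<and>
    (\<forall>h. profile L h \<longrightarrow> (\<forall>r\<in>{0..L}. h r \<le> m) \<longrightarrow>
       steklov_sigma L (revolution_metric h :: 'n metric) 1 \<le> ereal t)"
proof -
  define X where "X = 1 + L / 2"
  have X: "X > 1" using L by (simp add: X_def)
  \<comment> \<open>The truncated envelope bounds every admissible profile on the left half, and its
    mirror image does so on the right half.\<close>
  define k where "k t = inverse (min (1 + t) m ^ (N + 2))" for t
  define H where "H t = integral {0..t} k" for t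
  have k0: "0 < k t" if "t \<in> {0..L/2}" for t using that m by (simp add: k_def)
  have "continuous_on {0..L/2} k"
    unfolding k_def using m by (intro continuous_intros) auto
  then have H: "(H has_real_derivative k t) (at t within {0..L/2})" if "t \<in> {0..L/2}" for t
    unfolding H_def by (rule integral_has_real_derivative_within[OF _ that])
  have H0: "H 0 = 0" by (simp add: H_def)
  \<comment> \<open>A primitive for the untruncated envelope; its increment over the left half is
    the reciprocal of the first term of \<open>B\<close>.\<close>
  define F where "F t = - (inverse (1 + t) ^ (N + 1)) / (real N + 1)" for t
  have F: "(F has_real_derivative inverse ((1 + t) ^ (N + 2))) (at t within {0..L/2})"
    if "t \<in> {0..L/2}" for t
  proof -
    have i: "((\<lambda>t. inverse (1 + t)) has_real_derivative - (inverse (1 + t) ^ 2)) (at t within {0..L/2})"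
      using that by (auto intro!: derivative_eq_intros simp: power2_eq_square)
    have "real (N + 1) * (inverse (1 + t) ^ 2 * inverse (1 + t) ^ N) / (real N + 1) = inverse ((1 + t) ^ (N + 2))"
      by (simp add: power_inverse[symmetric] power_add add.commute power2_eq_square)
    then show ?thesis
      unfolding F_def by (intro DERIV_cong[OF DERIV_cdivide[OF DERIV_minus[OF DERIV_power[OF i]]]]) simp
  qed
  have "F (L/2) - F 0 < H (L/2) - H 0"
  proof (rule deriv_less_imp_diff_less[OF _ _ H F, where s = "m - 1"])
    show "inverse ((1 + r) ^ (N + 2)) \<le> k r" if "r \<in> {0..L/2}" for r
      unfolding k_def using that m by (intro le_imp_inverse_le power_mono) auto
    show "inverse ((1 + r) ^ (N + 2)) < k r" if "m - 1 < r" "r < L/2" for r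
      unfolding k_def using that m by (intro less_imp_inverse_less power_strict_mono) auto
  qed (use m in auto)
  moreover have XN: "1 < X ^ (N + 1)" using X by (intro one_less_power) auto
  then have "F (L/2) - F 0 = (X ^ (N + 1) - 1) / ((real N + 1) * X ^ (N + 1))"
  proof -
    have "(1 - inverse Y) / M = (Y - 1) / (M * Y)" if "Y > 1" "M > 0" for Y M :: real
      using that by (simp add: field_simps)
    from this[OF XN, of "real N + 1"] show ?thesis
      by (simp add: F_def X_def[symmetric] power_inverse[symmetric] diff_divide_distrib)
  qed
  ultimately have gt: "(X ^ (N + 1) - 1) / ((real N + 1) * X ^ (N + 1)) < H (L/2)"
    using H0 by simp
  have q: "0 < (X ^ (N + 1) - 1) / ((real N + 1) * X ^ (N + 1))"
    using XN by (intro divide_pos_pos mult_pos_pos) auto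
  then have Hpos: "0 < H (L/2)" using gt by linarith
  have "steklov_sigma L (revolution_metric h :: 'n metric) 1 \<le> ereal (1 / H (L/2))"
    if h: "profile L h" and hm: "\<forall>r\<in>{0..L}. h r \<le> m" for h
  proof -
    note hD = profileD[OF h L]
    define A where "A r = integral {0..r} (\<lambda>r. inverse (h r ^ (N + 2)))" for r
    have A: "(A has_real_derivative inverse (h r ^ (N + 2))) (at r within {0..L})" if "r \<in> {0..L}" for r
      unfolding A_def by (rule integral_has_real_derivative_within[OF profile_powers_continuous(1)[OF h L] that])
    have A_sub: "(A has_real_derivative inverse (h r ^ (N + 2))) (at r within S)" if "r \<in> S" "S \<subseteq> {0..L}" for r S
      using A that by (meson DERIV_subset subsetD)
    have A0: "A 0 = 0" by (simp add: A_def)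
    have "H (L/2) - H 0 \<le> A (L/2) - A 0"
    proof (rule deriv_le_imp_diff_le[OF _ A_sub H])
      show "k r \<le> inverse (h r ^ (N + 2))" if "r \<in> {0..L/2}" for r
        unfolding k_def using that hD(2)[of r] hm profile_le[OF h L, of r]
        by (intro le_imp_inverse_le power_mono) auto
    qed (use L in auto)
    moreover have "- H (L - L) - - H (L - L/2) \<le> A L - A (L/2)"
    proof (rule deriv_le_imp_diff_le[of "L/2" L A _ "\<lambda>r. - H (L - r)" "\<lambda>r. k (L - r)", OF _ A_sub])
      show "((\<lambda>r. - H (L - r)) has_real_derivative k (L - r)) (at r within {L/2..L})"
        if "r \<in> {L/2..L}" for r
        using has_real_derivative_reflect[of H "k (L - r)" L r L "L/2"] H[of "L - r"] that DERIV_minus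
        by fastforce
      show "k (L - r) \<le> inverse (h r ^ (N + 2))" if "r \<in> {L/2..L}" for r
        unfolding k_def using that hD(2)[of r] hm profile_le[OF h L, of r] L
        by (intro le_imp_inverse_le power_mono) auto
    qed (use L in auto)
    ultimately have AL: "2 * H (L/2) \<le> A L" using A0 H0 by simp
    then have ALpos: "0 < A L" using Hpos by linarith
    interpret angular_eigenfunction "\<lambda>x::real^'n. 1" "\<lambda>x. 0" "\<lambda>x v. 0" 0
      by (rule angular_eigenfunction_one)
    \<comment> \<open>Constant flux 1 means outward fluxes -1 and 1. Subtracting half of the total
      makes the boundary values opposite as well, so one \<sigma> fits both ends.\<close>
    have "(\<lambda>x::real^'n. (\<lambda>r. A r - A L / 2) (norm x - 1) * 1) \<in>
        steklov_eigenspace (shell L) (pullback_metric (revolution_metric h)) (2 / A L)"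
    proof (rule separated_steklov_eigenfunction[OF _ L h, where w = "\<lambda>r. 1"])
      show "((\<lambda>r. A r - A L / 2) has_real_derivative inverse (h r ^ (CARD('n) - 1)) * 1) (at r within {0..L})"
        if "r \<in> {0..L}" for r
        using DERIV_diff[OF A[OF that] DERIV_const[of "A L / 2"]] by (simp add: n)
    qed (use n A0 ALpos in \<open>auto simp: field_simps\<close>)
    moreover have "2 / A L \<le> 1 / H (L/2)"
      using AL Hpos ALpos by (simp add: field_simps)
    moreover have "axis undefined 1 \<in> (shell L :: (real^'n) set)"
        "(1 + L) *\<^sub>R axis undefined 1 \<in> (shell L :: (real^'n) set)"
      using L by (auto simp: shell_def)
    ultimately show ?thesis
      using Hpos A0 ALpos L n
      by (intro steklov_sigma_1_le[OF _ L h, where x = "axis undefined 1" and y = "(1 + L) *\<^sub>R axis undefined 1"]) auto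
  qed
  moreover have "1 / H (L/2) < (real N + 1) * X ^ (N + 1) / (X ^ (N + 1) - 1)"
    using less_imp_inverse_less[OF gt q] by (simp add: inverse_eq_divide)
  ultimately show ?thesis
    using Hpos unfolding X_def by (intro exI[of _ "1 / H (L/2)"]) auto
qed

section \<open>The comparison function on the flat annulus\<close>

text \<open>\<open>annulus_mode (n - 3) X (norm x - 1) * x $ i / norm x\<close> is the harmonic function on the
  annulus with radii 1 and X in dimension n that satisfies the Neumann condition on the outer
  sphere and equals \<open>x $ i\<close> on the unit sphere.\<close>

definition annulus_mode :: "nat \<Rightarrow> real \<Rightarrow> real \<Rightarrow> real" where
  "annulus_mode N X t =
     ((1 + t) + X ^ (N + 3) / (real N + 2) / (1 + t) ^ (N + 2)) / (1 + X ^ (N + 3) / (real N + 2))"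

definition annulus_mode_deriv :: "nat \<Rightarrow> real \<Rightarrow> real \<Rightarrow> real" where
  "annulus_mode_deriv N X t = (1 - (X / (1 + t)) ^ (N + 3)) / (1 + X ^ (N + 3) / (real N + 2))"

lemma shifted_power_has_real_derivative:
  "((\<lambda>t::real. (1 + t) ^ Suc j) has_real_derivative (1 + real j) * (1 + t) ^ j) (at t within S)"
proof -
  have "((\<lambda>t::real. 1 + t) has_real_derivative 1) (at t within S)"
    by (auto intro!: derivative_eq_intros)
  from DERIV_power_Suc[OF this, of j] show ?thesis by simp
qed

lemma inverse_shifted_power_has_real_derivative:
  fixes t :: real
  assumes "0 \<le> t"
  shows "((\<lambda>t. c / (1 + t) ^ Suc j) has_real_derivative - ((1 + real j) * c / (1 + t) ^ Suc (Suc j))) (at t within S)"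
proof -
  have "(0 * y ^ Suc j - c * (k * y ^ j)) / (y ^ Suc j * y ^ Suc j) = - (k * c / y ^ Suc (Suc j))"
    if "y \<noteq> 0" for y k :: real
    using that by (simp add: field_simps)
  from this[of "1 + t" "1 + real j"] assms show ?thesis
    by (intro DERIV_cong[OF DERIV_divide[OF DERIV_const shifted_power_has_real_derivative]]) auto
qed

lemma annulus_mode_has_derivative:
  assumes "0 \<le> t" "0 < X"
  shows "(annulus_mode N X has_real_derivative annulus_mode_deriv N X t) (at t within S)"
proof -
  have d: "((\<lambda>t. X ^ (N + 3) / (real N + 2) / (1 + t) ^ (N + 2)) has_real_derivative
      - ((X / (1 + t)) ^ (N + 3))) (at t within S)"
  proof -
    have "N + 2 = Suc (N + 1)" "N + 3 = Suc (Suc (N + 1))" by simp_all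
    moreover have "- ((1 + real (N + 1)) * (X ^ (N + 3) / (real N + 2)) / y) = - (X ^ (N + 3) / y)" for y
    proof -
      have "M * (W / M) / y = W / y" if "M > 0" for M W :: real
        using that by simp
      from this[of "1 + real (N + 1)" "X ^ (N + 3)"] show ?thesis by (simp add: add.commute)
    qed
    ultimately show ?thesis
      using inverse_shifted_power_has_real_derivative[OF assms(1), of "X ^ (N + 3) / (real N + 2)" "N + 1" S]
      by (simp only: power_divide)
  qed
  have "((\<lambda>t. 1 + t) has_real_derivative 1) (at t within S)"
    by (auto intro!: derivative_eq_intros)
  from DERIV_cdivide[OF DERIV_add[OF this d]] show ?thesis
    unfolding annulus_mode_def[abs_def] annulus_mode_deriv_def by simp
qed

text \<open>This is the separated equation for the profile 1 + t, that of the flat annulus, with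
  spherical eigenvalue N + 2.\<close>

lemma annulus_flux_has_derivative:
  assumes "0 \<le> t" "0 < X"
  shows "((\<lambda>t. (1 + t) ^ (N + 2) * annulus_mode_deriv N X t) has_real_derivative
      (real N + 2) * (1 + t) ^ N * annulus_mode N X t) (at t within S)"
proof -
  define K where "K = 1 + X ^ (N + 3) / (real N + 2)"
  have K: "K > 0" using assms by (simp add: K_def add_pos_nonneg)
  have p: "((\<lambda>t. (1 + t) ^ (N + 2)) has_real_derivative (real N + 2) * (1 + t) ^ (N + 1)) (at t within S)"
    using shifted_power_has_real_derivative[of "N + 1" t S] by (simp add: add.commute)
  have eq: "(1 + s) ^ (N + 2) * annulus_mode_deriv N X s = ((1 + s) ^ (N + 2) - X ^ (N + 3) / (1 + s) ^ Suc 0) / K"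
    for s
  proof -
    have "y ^ (N + 2) * ((1 - (X / y) ^ (N + 3)) / K) = (y ^ (N + 2) - X ^ (N + 3) / y ^ Suc 0) / K" for y
    proof (cases "y = 0")
      case False
      moreover have "y ^ (N + 3) = y ^ (N + 2) * y" by (simp add: eval_nat_numeral)
      ultimately show ?thesis
        using K by (simp add: power_divide right_diff_distrib)
    qed simp
    then show ?thesis by (simp only: annulus_mode_deriv_def K_def)
  qed
  have alg: "(M * (p * y) - - ((1 + real 0) * W / y ^ Suc (Suc 0))) / K = M * p * ((y + W / M / (p * y\<^sup>2)) / K)"
    if "y \<noteq> 0" "M \<noteq> 0" "p \<noteq> 0" for y M p W :: real
    using that K by (simp add: field_simps power2_eq_square)
  have y: "(1 + t) ^ (N + 1) = (1 + t) ^ N * (1 + t)" "(1 + t) ^ (N + 2) = (1 + t) ^ N * (1 + t)\<^sup>2"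
    by (simp_all add: power_add power2_eq_square)
  show ?thesis
    unfolding eq annulus_mode_def K_def[symmetric]
    by (rule DERIV_cong[OF DERIV_cdivide[OF DERIV_diff[OF p inverse_shifted_power_has_real_derivative[OF assms(1)]]]],
        unfold y, rule alg) (use assms(1) in auto)
qed

lemma linear_steklov_bound:
  fixes L m :: real
  assumes n: "CARD('n::finite) = N + 3" and L: "0 < L" and m: "1 \<le> m" "m < 1 + L / 2"
  shows "\<exists>t\<ge>0. t < (real N + 2) * ((1 + L / 2) ^ (N + 3) - 1) / ((1 + L / 2) ^ (N + 3) + real N + 2) \<and>
    (\<forall>h. profile L h \<longrightarrow> (\<forall>r\<in>{0..L}. h r \<le> m) \<longrightarrow>
       steklov_sigma L (revolution_metric h :: 'n metric) 1 \<le> ereal t)"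
proof -
  define X where "X = 1 + L / 2"
  have X: "X > 1" using L by (simp add: X_def)
  define \<phi> where "\<phi> = annulus_mode N X"
  define \<phi>' where "\<phi>' = annulus_mode_deriv N X"
  have \<phi>: "(\<phi> has_real_derivative \<phi>' t) (at t within S)" if "0 \<le> t" for t S
    unfolding \<phi>_def \<phi>'_def using that X by (intro annulus_mode_has_derivative) auto
  have flux: "((\<lambda>t. (1 + t) ^ (N + 2) * \<phi>' t) has_real_derivative (real N + 2) * (1 + t) ^ N * \<phi> t) (at t within S)"
    if "0 \<le> t" for t S
    unfolding \<phi>_def \<phi>'_def using that X by (intro annulus_flux_has_derivative) auto
  have K: "0 < 1 + X ^ (N + 3) / (real N + 2)" using X by (simp add: add_pos_nonneg)
  then have \<phi>0: "\<phi> 0 = 1" by (simp add: \<phi>_def annulus_mode_def)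
  \<comment> \<open>The energy density of the mode for a profile with value \<open>k\<close>. With
    the mode fixed it increases with \<open>k\<close>, so energies compare pointwise.\<close>
  define e where "e k t = k ^ (N + 2) * (\<phi>' t)\<^sup>2 + (real N + 2) * k ^ N * (\<phi> t)\<^sup>2" for k t
  define g where "g t = e (min (1 + t) m) t" for t
  define G where "G t = integral {0..t} g" for t
  have e_mono: "e k t \<le> e k' t" if "0 \<le> k" "k \<le> k'" for k k' t
    unfolding e_def using that by (intro add_mono mult_right_mono mult_left_mono power_mono) auto
  have "continuous_on {0..L/2} \<phi>"
    by (rule DERIV_continuous_on, rule \<phi>) simp
  moreover have "continuous_on {0..L/2} \<phi>'"
    unfolding \<phi>'_def annulus_mode_deriv_def using K by (intro continuous_intros) auto
  ultimately have "continuous_on {0..L/2} g"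
    unfolding g_def e_def by (intro continuous_intros)
  then have G: "(G has_real_derivative g t) (at t within {0..L/2})" if "t \<in> {0..L/2}" for t
    unfolding G_def by (rule integral_has_real_derivative_within[OF _ that])
  have G0: "G 0 = 0" by (simp add: G_def)
  have g0: "0 \<le> g t" if "t \<in> {0..L/2}" for t
    unfolding g_def e_def using that m by (intro add_nonneg_nonneg mult_nonneg_nonneg) auto
  have "0 - 0 \<le> G (L/2) - G 0"
    by (rule deriv_le_imp_diff_le[OF _ G, of "\<lambda>_. 0" "\<lambda>_. 0"]) (use L g0 in auto)
  then have Gnn: "0 \<le> G (L/2)" using G0 by simp
  \<comment> \<open>By the equation of the mode, flux times mode is a primitive of the untruncated
    energy density. It vanishes at L/2 by the Neumann condition, and minus its value at 0 is the
    second term of \<open>B\<close>.\<close>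
  define F where "F t = (1 + t) ^ (N + 2) * \<phi>' t * \<phi> t" for t
  have F: "(F has_real_derivative e (1 + t) t) (at t within {0..L/2})" if "t \<in> {0..L/2}" for t
    unfolding F_def using that
    by (intro DERIV_cong[OF DERIV_mult[OF flux \<phi>]]) (auto simp: e_def power2_eq_square algebra_simps)
  have "G (L/2) - G 0 < F (L/2) - F 0"
  proof (rule deriv_less_imp_diff_less[OF _ _ F G, where s = "m - 1"])
    show "g r \<le> e (1 + r) r" if "r \<in> {0..L/2}" for r
      unfolding g_def using that m by (intro e_mono) auto
    show "g r < e (1 + r) r" if r: "m - 1 < r" "r < L/2" for r
    proof -
      \<comment> \<open>The strict gain must come from the gradient term, because for N = 0 the
        other term does not depend on \<open>k\<close>. The slope vanishes only where 1 + r = X, at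
        the end of the interval.\<close>
      have "1 < X / (1 + r)" using r m by (simp add: X_def)
      then have "1 < (X / (1 + r)) ^ (N + 3)" by (intro one_less_power) auto
      then have "\<phi>' r \<noteq> 0" using K by (simp add: \<phi>'_def annulus_mode_deriv_def)
      then have "min (1 + r) m ^ (N + 2) * (\<phi>' r)\<^sup>2 < (1 + r) ^ (N + 2) * (\<phi>' r)\<^sup>2"
        using r m by (intro mult_strict_right_mono power_strict_mono) auto
      moreover have "(real N + 2) * min (1 + r) m ^ N * (\<phi> r)\<^sup>2 \<le> (real N + 2) * (1 + r) ^ N * (\<phi> r)\<^sup>2"
        using r m by (intro mult_right_mono mult_left_mono power_mono) auto
      ultimately show ?thesis unfolding g_def e_def by linarith
    qed
  qed (use m in auto)
  moreover have "F (L/2) = 0"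
    using X by (simp add: F_def \<phi>'_def annulus_mode_deriv_def X_def[symmetric])
  moreover have "F 0 = - ((real N + 2) * (X ^ (N + 3) - 1) / (X ^ (N + 3) + real N + 2))"
  proof -
    have "X ^ (N + 3) + real N + 2 \<noteq> 0" "real N + 2 + X ^ (N + 3) \<noteq> 0"
      using X by (smt (verit) of_nat_0_le_iff zero_less_power)+
    then show ?thesis
      using \<phi>0 K by (simp add: F_def \<phi>'_def annulus_mode_deriv_def divide_simps) (simp add: algebra_simps)
  qed
  ultimately have less: "G (L/2) < (real N + 2) * (X ^ (N + 3) - 1) / (X ^ (N + 3) + real N + 2)"
    using G0 by simp
  have "steklov_sigma L (revolution_metric h :: 'n metric) 1 \<le> ereal (G (L/2))"
    if h: "profile L h" and hm: "\<forall>r\<in>{0..L}. h r \<le> m" for h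
  proof -
    note hD = profileD[OF h L]
    let ?p = "\<lambda>r. h r ^ (N + 2)" and ?q = "\<lambda>r. (real N + 2) * h r ^ N"
    have pos: "0 < ?p r" "0 \<le> ?q r" if "r \<in> {0..L}" for r
      using hD(2)[OF that] by auto
    obtain a w \<sigma> b v where
      a: "solves_linear_system L (\<lambda>r. inverse (?p r)) ?q a w" "a 0 = 1" "- w 0 = \<sigma> * a 0" "w L = \<sigma> * a L"
      and b: "solves_linear_system L (\<lambda>r. inverse (?p r)) ?q b v" "b 0 = 1" "b L = 1" "2 * \<sigma> \<le> v L - v 0"
    proof (rule two_point_steklov[OF L profile_powers_continuous[OF h L], of "N + 2" "real N + 2" N])
      show "0 < inverse (?p r)" "0 \<le> ?q r" if "r \<in> {0..L}" for r
        using pos[OF that] by (simp_all only: positive_imp_inverse_positive)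
    qed (rule that; assumption)
    have b_sub: "(b has_real_derivative inverse (?p r) * v r) (at r within S)"
      "(v has_real_derivative ?q r * b r) (at r within S)" if "r \<in> S" "S \<subseteq> {0..L}" for r S
      using solves_linear_systemD[OF b(1)] that by (meson DERIV_subset subsetD)+
    have "(2 * v (L/2) * \<phi> (L/2) - v (L/2) * b (L/2)) - (2 * v 0 * \<phi> 0 - v 0 * b 0) \<le> G (L/2) - G 0"
    proof (rule dirichlet_calibration[OF _ b_sub \<phi> G])
      show "?p r * (\<phi>' r)\<^sup>2 + ?q r * (\<phi> r)\<^sup>2 \<le> g r" if "r \<in> {0..L/2}" for r
        unfolding g_def e_def[symmetric]
        using that hD(2)[of r] hm profile_le[OF h L, of r] by (intro e_mono) auto
    qed (use L pos in auto)
    moreover have "(2 * v L * \<phi> (L - L) - v L * b L) - (2 * v (L/2) * \<phi> (L - L/2) - v (L/2) * b (L/2))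
        \<le> - G (L - L) - - G (L - L/2)"
    proof (rule dirichlet_calibration[where \<phi> = "\<lambda>r. \<phi> (L - r)" and \<phi>' = "\<lambda>r. - \<phi>' (L - r)"
          and G = "\<lambda>r. - G (L - r)" and g = "\<lambda>r. g (L - r)", OF _ b_sub])
      fix r assume r: "r \<in> {L/2..L}"
      show "((\<lambda>r. \<phi> (L - r)) has_real_derivative - \<phi>' (L - r)) (at r within {L/2..L})"
        using r by (intro has_real_derivative_reflect \<phi>) auto
      show "((\<lambda>r. - G (L - r)) has_real_derivative g (L - r)) (at r within {L/2..L})"
        using has_real_derivative_reflect[of G "g (L - r)" L r L "L/2"] G[of "L - r"] r DERIV_minus
        by fastforce
      show "?p r * (- \<phi>' (L - r))\<^sup>2 + ?q r * (\<phi> (L - r))\<^sup>2 \<le> g (L - r)"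
        unfolding g_def power2_minus e_def[symmetric]
        using r L hD(2)[of r] hm profile_le[OF h L, of r] by (intro e_mono) auto
    qed (use L pos in auto)
    \<comment> \<open>The midpoint terms, in which \<open>b\<close> and \<phi> may differ, cancel
      because the mode is reflected there. At 0 and L both functions equal 1, so only the flux
      remains.\<close>
    ultimately have "v L - v 0 \<le> 2 * G (L/2)"
      using b \<phi>0 G0 by simp
    then have \<sigma>: "\<sigma> \<le> G (L/2)" using b(4) by linarith
    fix i :: 'n
    interpret angular_eigenfunction "\<lambda>x. x $ i / norm x"
        "\<lambda>x. axis i 1 /\<^sub>R norm x - (x $ i / norm x ^ 3) *\<^sub>R x"
        "\<lambda>x v. - ((x \<bullet> v) / norm x ^ 3) *\<^sub>R axis i 1 - (v $ i / norm x ^ 3) *\<^sub>R x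
          - (x $ i / norm x ^ 3) *\<^sub>R v + (3 * x $ i * (x \<bullet> v) / norm x ^ 5) *\<^sub>R x"
        "real CARD('n) - 1"
      by (rule angular_eigenfunction_coordinate)
    have f: "(\<lambda>x. a (norm x - 1) * (x $ i / norm x)) \<in>
        steklov_eigenspace (shell L) (pullback_metric (revolution_metric h)) \<sigma>"
      by (rule separated_steklov_eigenfunction[OF _ L h _ _ a(3,4)])
        (use solves_linear_systemD[OF a(1)] n in \<open>auto simp: add.commute\<close>)
    \<comment> \<open>On the inner sphere \<open>a\<close> is 1, so these antipodal points give the
      values 1 and -1.\<close>
    have "axis i 1 \<in> (shell L :: (real^'n) set)" "- axis i 1 \<in> (shell L :: (real^'n) set)"
      using L by (auto simp: shell_def)
    then show ?thesis
      using a(2) n by (intro steklov_sigma_1_le[OF _ L h f \<sigma> Gnn, of "axis i 1" "- axis i 1"]) auto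
  qed
  with Gnn less show ?thesis
    unfolding X_def by blast
qed

theorem theorem7:
  fixes L m :: real
  assumes "CARD('n::finite) \<ge> 3" and "L > 0" and "1 \<le> m" and "m < 1 + L / 2"
  shows "\<exists>C::real. C > 0 \<and>
           (\<forall>g \<in> (revolution_metrics L m :: 'n metric set).
              ereal (B (CARD('n)) L) - steklov_sigma L g 1 \<ge> ereal C)"
proof -
  obtain N where n: "CARD('n) = N + 3"
    using assms(1) by (metis add.commute le_Suc_ex)
  define B1 where "B1 = (real N + 1) * (1 + L / 2) ^ (N + 1) / ((1 + L / 2) ^ (N + 1) - 1)"
  define B2 where "B2 = (real N + 2) * ((1 + L / 2) ^ (N + 3) - 1) / ((1 + L / 2) ^ (N + 3) + real N + 2)"
  have B: "B CARD('n) L = min B1 B2"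
    by (simp add: B_def n B1_def B2_def algebra_simps)
  obtain t1 where t1: "t1 < B1" "\<And>h. profile L h \<Longrightarrow> \<forall>r\<in>{0..L}. h r \<le> m \<Longrightarrow>
      steklov_sigma L (revolution_metric h :: 'n metric) 1 \<le> ereal t1"
    using radial_steklov_bound[OF n assms(2-4)] unfolding B1_def by blast
  obtain t2 where t2: "t2 < B2" "\<And>h. profile L h \<Longrightarrow> \<forall>r\<in>{0..L}. h r \<le> m \<Longrightarrow>
      steklov_sigma L (revolution_metric h :: 'n metric) 1 \<le> ereal t2"
    using linear_steklov_bound[OF n assms(2-4)] unfolding B2_def by blast
  show ?thesis
  proof (intro exI conjI ballI)
    \<comment> \<open>Whichever of \<open>B1\<close> and \<open>B2\<close> is smaller, the minimum
      of \<open>t1\<close> and \<open>t2\<close> lies below the matching one, so the smaller of the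
      two gaps always remains.\<close>
    show "0 < min (B1 - t1) (B2 - t2)" using t1(1) t2(1) by simp
    fix g :: "'n metric" assume "g \<in> revolution_metrics L m"
    then obtain h where h: "g = revolution_metric h" "profile L h" "\<forall>r\<in>{0..L}. h r \<le> m"
      unfolding revolution_metrics_def by blast
    have "steklov_sigma L g 1 \<le> ereal (min t1 t2)"
      using t1(2)[OF h(2,3)] t2(2)[OF h(2,3)] h(1) by (simp add: min_def)
    then have "ereal (min B1 B2) - ereal (min t1 t2) \<le> ereal (min B1 B2) - steklov_sigma L g 1"
      by (intro ereal_minus_mono order_refl)
    moreover have "ereal (min (B1 - t1) (B2 - t2)) \<le> ereal (min B1 B2) - ereal (min t1 t2)"
      by (simp add: min_def)
    ultimately show "ereal (min (B1 - t1) (B2 - t2)) \<le> ereal (B CARD('n) L) - steklov_sigma L g 1"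
      unfolding B by (rule order_trans[rotated])
  qed
qed

end
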